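(* Let $R>0$, $K>0$. Then \[ \lim_{n\to\infty}\ \min_{\mathcal{C}_n} -\tfrac1n\log\big[1-P_e(\mathcal{C}_n)\big]=E_c(R,K),\qquad E_c(R,K)=\min_{PU}\Big\{D(U\|W|P)+\big|R-I_{PU}-|B_{PU}-K|^{+}\big|^{+}\Big\}, \] where the minimum is over codebooks $\mathcal{C}_n$ of block length $n$ with $\lfloor e^{nR}\rfloor$ codewords. Moreover, this exponent is achievable by random coding: for a suitable input distribution $P$, codebooks with letters drawn i.i.d. according to $P$ satisfy $\limsup_{n\to\infty}-\tfrac1n\log[1-\overline{P}_e^{(n)}]\le E_c(R,K)$, where $\overline{P}_e^{(n)}$ is the error probability averaged also over the random codebook.
   Context: Channel model: $\mathcal{X},\mathcal{Y}$ finite alphabets, $W(y|x)$ a fixed conditional distribution. A codebook $\mathcal{C}_n$ consists of $\lfloor e^{nR}\rfloor$ codewords $\mathbf{x}_m\in\mathcal{X}^n$. A channel instance: independently for each message $m$, a cloud of $\lfloor e^{nK}\rfloor$ independent sequences $\mathbf{y}\in\mathcal{Y}^n$ whose letters are independent with $y_i\sim W(\cdot|x_{m,i})$. Messages are equiprobable; when $m$ is sent, the output is a uniformly chosen vector of the cloud of $m$. The decoder knows codebook and clouds; the ML decoder outputs a message whose cloud contains the most copies of the received vector (ties broken at random). $P_e(\mathcal{C}_n)$ is the ML error probability averaged over messages and channel instances. Logs are natural. $P$ ranges over distributions on $\mathcal{X}$ and $U(y|x)$ over conditional distributions; $PU$ is $P(x)U(y|x)$. $D(U\|W|P)=\sum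 P(x)U(y|x)\log\frac{U(y|x)}{W(y|x)}$; $I_{PU}$ is the mutual information under $PU$; $B_{PU}=\mathbb{E}_{PU}[-\log W(Y|X)]$; $|t|^{+}=\max\{0,t\}$. *)

theory Defs
  imports "HOL-Analysis.Analysis"
begin

definition stoch_matrix :: "('x::finite \<Rightarrow> 'y::finite \<Rightarrow> real) \<Rightarrow> bool" where
  "stoch_matrix W \<longleftrightarrow> (\<forall>x y. 0 \<le> W x y) \<and> (\<forall>x. (\<Sum>y\<in>UNIV. W x y) = 1)"

definition prob_distr :: "('x::finite \<Rightarrow> real) \<Rightarrow> bool" where
  "prob_distr P \<longleftrightarrow> (\<forall>x. 0 \<le> P x) \<and> (\<Sum>x\<in>UNIV. P x) = 1"

definition pos_part :: "real \<Rightarrow> real" where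
  "pos_part t = max 0 t"

text \<open>Conditional divergence D(U||W|P) (convention 0 log 0 = 0, automatically
  since 0 * _ = 0).\<close>
definition cond_div :: "('x::finite \<Rightarrow> 'y::finite \<Rightarrow> real) \<Rightarrow> ('x \<Rightarrow> real) \<Rightarrow> ('x \<Rightarrow> 'y \<Rightarrow> real) \<Rightarrow> real" where
  "cond_div W P U = (\<Sum>x\<in>UNIV. \<Sum>y\<in>UNIV. P x * U x y * ln (U x y / W x y))"

definition mut_info :: "('x::finite \<Rightarrow> real) \<Rightarrow> ('x \<Rightarrow> 'y::finite \<Rightarrow> real) \<Rightarrow> real" where
  "mut_info P U = (\<Sum>x\<in>UNIV. \<Sum>y\<in>UNIV.
      P x * U x y * ln (U x y / (\<Sum>x'\<in>UNIV. P x' * U x' y)))"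

definition B_term :: "('x::finite \<Rightarrow> 'y::finite \<Rightarrow> real) \<Rightarrow> ('x \<Rightarrow> real) \<Rightarrow> ('x \<Rightarrow> 'y \<Rightarrow> real) \<Rightarrow> real" where
  "B_term W P U = (\<Sum>x\<in>UNIV. \<Sum>y\<in>UNIV. P x * U x y * (- ln (W x y)))"

text \<open>The exponent E_c(R,K).  Pairs (P,U) for which PU is not absolutely continuous
  w.r.t. PW have D(U||W|P) = +infinity and can never attain the minimum (U = W gives
  a finite value), so the minimum is taken over pairs with PU << PW.\<close>
definition E_c :: "('x::finite \<Rightarrow> 'y::finite \<Rightarrow> real) \<Rightarrow> real \<Rightarrow> real \<Rightarrow> real" where
  "E_c W R K = Inf {cond_div W P U + pos_part (R - mut_info P U - pos_part (B_term W P U - K)) | P U.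
       prob_distr P \<and> (\<forall>x. prob_distr (U x)) \<and>
       (\<forall>x y. P x * U x y > 0 \<longrightarrow> W x y > 0)}"

definition seqs :: "nat \<Rightarrow> (nat \<Rightarrow> 'y::finite) set" where
  "seqs n = PiE {..<n} (\<lambda>_. UNIV)"

definition num_msgs :: "real \<Rightarrow> nat \<Rightarrow> nat" where
  "num_msgs R n = nat \<lfloor>exp (real n * R)\<rfloor>"

text \<open>A codebook C maps (m, i) to the i-th letter of codeword m (m < M, i < n).
  A channel instance Y maps (m, j) (m < M, j < L) to the j-th sequence of the cloud of m.\<close>
definition instances :: "nat \<Rightarrow> nat \<Rightarrow> nat \<Rightarrow> (nat \<times> nat \<Rightarrow> nat \<Rightarrow> 'y::finite) set" where
  "instances n M L = PiE ({..<M} \<times> {..<L}) (\<lambda>_. seqs n)"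

definition inst_prob :: "('x::finite \<Rightarrow> 'y::finite \<Rightarrow> real) \<Rightarrow> nat \<Rightarrow> nat \<Rightarrow> nat \<Rightarrow> (nat \<times> nat \<Rightarrow> 'x)
     \<Rightarrow> (nat \<times> nat \<Rightarrow> nat \<Rightarrow> 'y) \<Rightarrow> real" where
  "inst_prob W n M L C Y = (\<Prod>mj\<in>{..<M} \<times> {..<L}. \<Prod>i<n. W (C (fst mj, i)) (Y mj i))"

definition cloud_count :: "nat \<Rightarrow> (nat \<times> nat \<Rightarrow> nat \<Rightarrow> 'y) \<Rightarrow> nat \<Rightarrow> (nat \<Rightarrow> 'y) \<Rightarrow> nat" where
  "cloud_count L Y m y = card {j\<in>{..<L}. Y (m, j) = y}"

definition ml_set :: "nat \<Rightarrow> nat \<Rightarrow> (nat \<times> nat \<Rightarrow> nat \<Rightarrow> 'y) \<Rightarrow> (nat \<Rightarrow> 'y) \<Rightarrow> nat set" where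
  "ml_set M L Y y = {m\<in>{..<M}. \<forall>m'\<in>{..<M}. cloud_count L Y m' y \<le> cloud_count L Y m y}"

definition ml_decode_prob :: "nat \<Rightarrow> nat \<Rightarrow> (nat \<times> nat \<Rightarrow> nat \<Rightarrow> 'y) \<Rightarrow> (nat \<Rightarrow> 'y) \<Rightarrow> nat \<Rightarrow> real" where
  "ml_decode_prob M L Y y m =
     (if m \<in> ml_set M L Y y then 1 / real (card (ml_set M L Y y)) else 0)"

definition err_prob :: "('x::finite \<Rightarrow> 'y::finite \<Rightarrow> real) \<Rightarrow> real \<Rightarrow> real \<Rightarrow> nat \<Rightarrow> (nat \<times> nat \<Rightarrow> 'x) \<Rightarrow> real" where
  "err_prob W R K n C =
     (let M = num_msgs R n; L = num_msgs K n in
      (\<Sum>Y\<in>instances n M L. inst_prob W n M L C Y *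
         ((\<Sum>m<M. \<Sum>j<L. 1 - ml_decode_prob M L Y (Y (m, j)) m) / (real M * real L))))"

definition codebooks :: "nat \<Rightarrow> nat \<Rightarrow> (nat \<times> nat \<Rightarrow> 'x::finite) set" where
  "codebooks M n = PiE ({..<M} \<times> {..<n}) (\<lambda>_. UNIV)"

definition avg_err_prob :: "('x::finite \<Rightarrow> 'y::finite \<Rightarrow> real) \<Rightarrow> real \<Rightarrow> real \<Rightarrow> ('x \<Rightarrow> real) \<Rightarrow> nat \<Rightarrow> real" where
  "avg_err_prob W R K P n =
     (\<Sum>C\<in>codebooks (num_msgs R n) n.
        (\<Prod>mi\<in>{..<num_msgs R n} \<times> {..<n}. P (C mi)) * err_prob W R K n C)"

end

theory Submission
  imports Defs "HOL-Real_Asymp.Real_Asymp"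
begin

text \<open>Summing the decoder's success over received vectors, \<open>1 - P\<^sub>e\<close> is \<open>1 / (M L)\<close> times the sum over
  \<open>y\<close> of the expected maximum, over messages, of the binomial number of copies of \<open>y\<close> in each cloud.

  Converse: split the messages by their joint type \<open>PU\<close> with \<open>y\<close>. All counts in one class are
  binomial with mean \<open>exp (n (K - B))\<close>, so the expected maximum is at most the sum of the means, and
  also, by an exponential moment bound, of the order \<open>n exp (n |K - B|\<^sup>+)\<close>. Summed over \<open>y\<close>, the
  two bounds give the exponents \<open>D\<close> and \<open>D + R - I - |B - K|\<^sup>+\<close>, and there are only polynomially many
  types.

  Achievability: the exponent is continuous on a compact set of pairs, hence attained at some \<open>PU\<close>.
  Draw the codebook from \<open>P\<close> and keep only pairs \<open>(x, y)\<close> typical for \<open>PU\<close>. A typical message has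
  \<open>exp (n |K - B|\<^sup>+)\<close> copies of \<open>y\<close> with probability about \<open>exp (- n |B - K|\<^sup>+)\<close>, and some
  message out of \<open>exp (n R)\<close> is typical and has that many copies with probability about
  \<open>min 1 (exp (n (R - I - |B - K|\<^sup>+)))\<close>.\<close>

section \<open>Expectations over codebooks and channel instances\<close>

definition seq_prob :: "('x \<Rightarrow> 'y \<Rightarrow> real) \<Rightarrow> nat \<Rightarrow> (nat \<Rightarrow> 'x) \<Rightarrow> (nat \<Rightarrow> 'y) \<Rightarrow> real" where
  "seq_prob W n x y = (\<Prod>i<n. W (x i) (y i))"

definition codeword :: "(nat \<times> nat \<Rightarrow> 'x) \<Rightarrow> nat \<Rightarrow> nat \<Rightarrow> 'x" where
  "codeword C m = (\<lambda>i. C (m, i))"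

definition inst_expect :: "('x::finite \<Rightarrow> 'y::finite \<Rightarrow> real) \<Rightarrow> nat \<Rightarrow> nat \<Rightarrow> nat \<Rightarrow> (nat \<times> nat \<Rightarrow> 'x)
     \<Rightarrow> ((nat \<times> nat \<Rightarrow> nat \<Rightarrow> 'y) \<Rightarrow> real) \<Rightarrow> real" where
  "inst_expect W n M L C F = (\<Sum>Y\<in>instances n M L. inst_prob W n M L C Y * F Y)"

definition max_count :: "nat \<Rightarrow> nat \<Rightarrow> (nat \<times> nat \<Rightarrow> nat \<Rightarrow> 'y) \<Rightarrow> (nat \<Rightarrow> 'y) \<Rightarrow> nat" where
  "max_count M L Y y = Max ((\<lambda>m. cloud_count L Y m y) ` {..<M})"

lemma finite_seqs [simp]: "finite (seqs n :: (nat \<Rightarrow> 'y::finite) set)"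
  unfolding seqs_def by (rule finite_PiE) auto

lemma finite_instances [simp]: "finite (instances n M L :: (nat \<times> nat \<Rightarrow> nat \<Rightarrow> 'y::finite) set)"
  unfolding instances_def by (rule finite_PiE) auto

lemma finite_codebooks [simp]: "finite (codebooks M n :: (nat \<times> nat \<Rightarrow> 'x::finite) set)"
  unfolding codebooks_def by (rule finite_PiE) auto

lemma codebooks_nonempty: "codebooks M n \<noteq> ({} :: (nat \<times> nat \<Rightarrow> 'x::finite) set)"
  unfolding codebooks_def by (simp add: PiE_eq_empty_iff)

lemma instances_seqs: "Y \<in> instances n M L \<Longrightarrow> m < M \<Longrightarrow> j < L \<Longrightarrow> Y (m, j) \<in> seqs n"
  unfolding instances_def by auto

lemma sum_seqs_prod:
  fixes f :: "nat \<Rightarrow> 'a::finite \<Rightarrow> real"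
  shows "(\<Sum>y\<in>seqs n. \<Prod>i<n. f i (y i)) = (\<Prod>i<n. \<Sum>a\<in>UNIV. f i a)"
  unfolding seqs_def by (rule prod_sum_PiE[symmetric]) auto

lemma seq_prob_nonneg: "stoch_matrix W \<Longrightarrow> 0 \<le> seq_prob W n x y"
  unfolding seq_prob_def stoch_matrix_def by (auto intro: prod_nonneg)

lemma sum_seq_prob: "stoch_matrix W \<Longrightarrow> (\<Sum>y\<in>seqs n. seq_prob W n x y) = 1"
  unfolding seq_prob_def sum_seqs_prod[where f = "\<lambda>i. W (x i)"] by (simp add: stoch_matrix_def)

lemma seq_prob_le_1: "stoch_matrix W \<Longrightarrow> y \<in> seqs n \<Longrightarrow> seq_prob W n x y \<le> 1"
  using member_le_sum[of y "seqs n" "seq_prob W n x"] by (simp add: seq_prob_nonneg sum_seq_prob)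

lemma inst_prob_eq: "inst_prob W n M L C Y = (\<Prod>mj\<in>{..<M} \<times> {..<L}. seq_prob W n (codeword C (fst mj)) (Y mj))"
  unfolding inst_prob_def seq_prob_def codeword_def ..

lemma inst_prob_nonneg: "stoch_matrix W \<Longrightarrow> 0 \<le> inst_prob W n M L C Y"
  unfolding inst_prob_eq by (auto intro: prod_nonneg seq_prob_nonneg)

text \<open>Independence of the cloud vectors: every pair of message and copy contributes its own
  factor. The moment computations below all pass through this identity.\<close>

lemma inst_expect_prod:
  "inst_expect W n M L C (\<lambda>Y. \<Prod>mj\<in>{..<M} \<times> {..<L}. f mj (Y mj)) =
   (\<Prod>mj\<in>{..<M} \<times> {..<L}. \<Sum>y\<in>seqs n. seq_prob W n (codeword C (fst mj)) y * f mj y)"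
  unfolding inst_expect_def inst_prob_eq prod.distrib[symmetric] instances_def
  by (rule prod_sum_PiE[symmetric]) auto

lemma inst_expect_const:
  assumes "stoch_matrix W" shows "inst_expect W n M L C (\<lambda>Y. c) = c"
proof -
  have "inst_expect W n M L C (\<lambda>Y. 1) = 1"
    using inst_expect_prod[of W n M L C "\<lambda>_ _. 1"] by (simp add: sum_seq_prob assms)
  then show ?thesis
    unfolding inst_expect_def by (simp add: sum_distrib_right[symmetric])
qed

lemma inst_expect_mono:
  assumes "stoch_matrix W" "\<And>Y. Y \<in> instances n M L \<Longrightarrow> F Y \<le> G Y"
  shows "inst_expect W n M L C F \<le> inst_expect W n M L C G"
  unfolding inst_expect_def using assms by (intro sum_mono mult_left_mono inst_prob_nonneg) auto

lemma inst_expect_cong: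
  assumes "\<And>Y. Y \<in> instances n M L \<Longrightarrow> F Y = G Y"
  shows "inst_expect W n M L C F = inst_expect W n M L C G"
  unfolding inst_expect_def using assms by (intro sum.cong) auto

lemma inst_expect_add: "inst_expect W n M L C (\<lambda>Y. F Y + G Y) = inst_expect W n M L C F + inst_expect W n M L C G"
  unfolding inst_expect_def by (simp add: algebra_simps sum.distrib)

lemma inst_expect_cmult: "inst_expect W n M L C (\<lambda>Y. c * F Y) = c * inst_expect W n M L C F"
  unfolding inst_expect_def by (simp add: sum_distrib_left mult_ac)

lemma inst_expect_sum: "inst_expect W n M L C (\<lambda>Y. \<Sum>i\<in>I. F i Y) = (\<Sum>i\<in>I. inst_expect W n M L C (F i))"
  unfolding inst_expect_def by (simp add: sum_distrib_left) (rule sum.swap)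

text \<open>Currying turns a codebook, a function on pairs, into a family of codewords, and sums
  over families factorise. The condition on \<open>F\<close> lets a row of the codebook be exchanged
  with its representative in \<open>seqs n\<close>.\<close>

lemma sum_codewords_prod:
  fixes F :: "nat \<Rightarrow> (nat \<Rightarrow> 'x::finite) \<Rightarrow> real"
  assumes F: "\<And>m x x'. (\<And>i. i < n \<Longrightarrow> x i = x' i) \<Longrightarrow> F m x = F m x'"
  shows "(\<Sum>C\<in>codebooks M n. \<Prod>m<M. F m (codeword C m)) = (\<Prod>m<M. \<Sum>x\<in>seqs n. F m x)"
proof -
  define enc :: "(nat \<Rightarrow> nat \<Rightarrow> 'x) \<Rightarrow> nat \<times> nat \<Rightarrow> 'x"
    where "enc g = (\<lambda>p\<in>{..<M} \<times> {..<n}. g (fst p) (snd p))" for g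
  have "(\<Prod>m<M. \<Sum>x\<in>seqs n. F m x) = (\<Sum>g\<in>PiE {..<M} (\<lambda>_. seqs n). \<Prod>m<M. F m (g m))"
    by (rule prod_sum_PiE) auto
  also have "\<dots> = (\<Sum>C\<in>codebooks M n. \<Prod>m<M. F m (codeword C m))"
  proof (rule sum.reindex_bij_witness[where j = enc and
        i = "\<lambda>C. \<lambda>m\<in>{..<M}. \<lambda>i\<in>{..<n}. C (m, i)"])
    fix g assume g: "g \<in> PiE {..<M} (\<lambda>_. seqs n :: (nat \<Rightarrow> 'x) set)"
    show "(\<lambda>m\<in>{..<M}. \<lambda>i\<in>{..<n}. enc g (m, i)) = g"
    proof
      fix m show "(\<lambda>m\<in>{..<M}. \<lambda>i\<in>{..<n}. enc g (m, i)) m = g m"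
      proof (cases "m < M")
        case True
        then have "g m \<in> extensional {..<n}" using g by (auto simp: seqs_def PiE_iff)
        then show ?thesis using True by (auto simp: enc_def extensional_def)
      next
        case False
        then show ?thesis using g by (auto simp: PiE_iff extensional_def)
      qed
    qed
    show "enc g \<in> codebooks M n" by (auto simp: enc_def codebooks_def)
    show "(\<Prod>m<M. F m (codeword (enc g) m)) = (\<Prod>m<M. F m (g m))"
      by (intro prod.cong refl F) (auto simp: codeword_def enc_def)
  next
    fix C :: "nat \<times> nat \<Rightarrow> 'x" assume "C \<in> codebooks M n"
    then show "enc (\<lambda>m\<in>{..<M}. \<lambda>i\<in>{..<n}. C (m, i)) = C"
      by (auto simp: enc_def codebooks_def PiE_iff extensional_def fun_eq_iff)
  qed (auto simp: seqs_def)
  finally show ?thesis ..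
qed

section \<open>Decoder success and maximal cloud counts\<close>

lemma cloud_count_le_max_count: "m < M \<Longrightarrow> cloud_count L Y m y \<le> max_count M L Y y"
  unfolding max_count_def by (intro Max_ge) auto

lemma max_count_attained:
  assumes "0 < M" obtains m where "m < M" "max_count M L Y y = cloud_count L Y m y"
proof -
  have "max_count M L Y y \<in> (\<lambda>m. cloud_count L Y m y) ` {..<M}"
    unfolding max_count_def using assms by (intro Max_in) auto
  then show ?thesis using that by auto
qed

lemma ml_set_eq: "0 < M \<Longrightarrow> ml_set M L Y y = {m\<in>{..<M}. cloud_count L Y m y = max_count M L Y y}"
proof -
  assume M: "0 < M"
  obtain m0 where m0: "m0 < M" "max_count M L Y y = cloud_count L Y m0 y"
    using max_count_attained[OF M] by blast
  have "(\<forall>m'\<in>{..<M}. cloud_count L Y m' y \<le> cloud_count L Y m y) \<longleftrightarrow> cloud_count L Y m y = max_count M L Y y"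
    if "m < M" for m
    using that m0 cloud_count_le_max_count[of _ M L Y y] by (auto intro: antisym)
  then show ?thesis unfolding ml_set_def by auto
qed

lemma sum_over_cloud:
  fixes g :: "(nat \<Rightarrow> 'y::finite) \<Rightarrow> real"
  assumes "\<And>j. j < L \<Longrightarrow> Y (m, j) \<in> seqs n"
  shows "(\<Sum>j<L. g (Y (m, j))) = (\<Sum>y\<in>seqs n. real (cloud_count L Y m y) * g y)"
proof -
  have "(\<Sum>j<L. g (Y (m, j))) = (\<Sum>j<L. \<Sum>y\<in>seqs n. if Y (m, j) = y then g y else 0)"
    using assms by (intro sum.cong) (auto simp: sum.delta')
  also have "\<dots> = (\<Sum>y\<in>seqs n. \<Sum>j<L. if Y (m, j) = y then g y else 0)"
    by (rule sum.swap)
  also have "\<dots> = (\<Sum>y\<in>seqs n. real (cloud_count L Y m y) * g y)"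
    by (intro sum.cong refl) (simp add: cloud_count_def sum.If_cases Int_def)
  finally show ?thesis .
qed

text \<open>The messages in \<open>ml_set\<close> all have the same maximal count of
  \<open>y\<close> and share the tie-breaking probability equally, so their weighted counts average
  back to that maximum. Ties thus disappear from the analysis.\<close>

lemma sum_ml_decode_prob:
  assumes M: "0 < M" and Y: "Y \<in> instances n M L"
  shows "(\<Sum>m<M. \<Sum>j<L. ml_decode_prob M L Y (Y (m, j)) m) = (\<Sum>y\<in>seqs n. real (max_count M L Y y))"
proof -
  have "(\<Sum>m<M. \<Sum>j<L. ml_decode_prob M L Y (Y (m, j)) m) =
      (\<Sum>m<M. \<Sum>y\<in>seqs n. real (cloud_count L Y m y) * ml_decode_prob M L Y y m)"
    using instances_seqs[OF Y] by (intro sum.cong refl sum_over_cloud) auto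
  also have "\<dots> = (\<Sum>y\<in>seqs n. \<Sum>m<M. real (cloud_count L Y m y) * ml_decode_prob M L Y y m)"
    by (rule sum.swap)
  also have "\<dots> = (\<Sum>y\<in>seqs n. real (max_count M L Y y))"
  proof (intro sum.cong refl)
    fix y :: "nat \<Rightarrow> 'a"
    have ne: "ml_set M L Y y \<noteq> {}" "finite (ml_set M L Y y)" "ml_set M L Y y \<subseteq> {..<M}"
    proof -
      obtain m where "m < M" "max_count M L Y y = cloud_count L Y m y"
        using max_count_attained[OF M] by blast
      then have "m \<in> ml_set M L Y y" by (simp add: ml_set_eq[OF M])
      then show "ml_set M L Y y \<noteq> {}" by auto
    qed (auto simp: ml_set_def)
    have "(\<Sum>m<M. real (cloud_count L Y m y) * ml_decode_prob M L Y y m)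
      = (\<Sum>m\<in>ml_set M L Y y. real (max_count M L Y y) / real (card (ml_set M L Y y)))"
      using ne by (intro sum.mono_neutral_cong_right) (auto simp: ml_decode_prob_def ml_set_eq[OF M])
    also have "\<dots> = real (max_count M L Y y)" using ne by (simp add: card_eq_0_iff)
    finally show "(\<Sum>m<M. real (cloud_count L Y m y) * ml_decode_prob M L Y y m) = real (max_count M L Y y)" .
  qed
  finally show ?thesis .
qed

text \<open>For a number that is at least 1, the floor loses at most a factor 2, which is invisible
  on the exponential scale.\<close>

lemma num_msgs_bounds:
  assumes "0 < R"
  shows "1 \<le> num_msgs R n" "real (num_msgs R n) \<le> exp (n * R)" "exp (n * R) / 2 \<le> real (num_msgs R n)"
proof -
  have e: "1 \<le> exp (n * R)" using assms by simp
  then have f: "1 \<le> \<lfloor>exp (n * R)\<rfloor>" by linarith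
  then show "1 \<le> num_msgs R n" "real (num_msgs R n) \<le> exp (n * R)" "exp (n * R) / 2 \<le> real (num_msgs R n)"
    unfolding num_msgs_def by linarith+
qed

lemma correct_prob_eq:
  fixes W :: "'x::finite \<Rightarrow> 'y::finite \<Rightarrow> real"
  assumes W: "stoch_matrix W" and "0 < R" "0 < K"
  shows "1 - err_prob W R K n C =
    (\<Sum>y\<in>seqs n. inst_expect W n (num_msgs R n) (num_msgs K n) C
        (\<lambda>Y. real (max_count (num_msgs R n) (num_msgs K n) Y y))) / (real (num_msgs R n) * real (num_msgs K n))"
proof -
  let ?M = "num_msgs R n" and ?L = "num_msgs K n"
  have pos: "0 < ?M" "0 < ?L" using num_msgs_bounds(1)[of R n] num_msgs_bounds(1)[of K n] assms by auto
  have "err_prob W R K n C = inst_expect W n ?M ?L C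
      (\<lambda>Y. (\<Sum>m<?M. \<Sum>j<?L. 1 - ml_decode_prob ?M ?L Y (Y (m, j)) m) / (real ?M * real ?L))"
    by (simp add: err_prob_def inst_expect_def Let_def)
  also have "\<dots> = inst_expect W n ?M ?L C
      (\<lambda>Y. 1 + (- 1 / (real ?M * real ?L)) * (\<Sum>y\<in>seqs n. real (max_count ?M ?L Y y)))"
    using pos by (intro inst_expect_cong) (simp add: sum_subtractf sum_ml_decode_prob field_simps)
  also have "\<dots> = 1 - inst_expect W n ?M ?L C
      (\<lambda>Y. (\<Sum>y\<in>seqs n. real (max_count ?M ?L Y y))) / (real ?M * real ?L)"
    unfolding inst_expect_add inst_expect_cmult inst_expect_const[OF W] by simp
  finally show ?thesis by (simp add: inst_expect_sum)
qed

section \<open>Moments of the cloud counts\<close>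

lemma sum_point_function:
  fixes p :: "(nat \<Rightarrow> 'y::finite) \<Rightarrow> real"
  assumes "y \<in> seqs n" "(\<Sum>z\<in>seqs n. p z) = 1"
  shows "(\<Sum>z\<in>seqs n. p z * (if z = y then c else 1)) = 1 + p y * (c - 1)"
proof -
  have "(\<Sum>z\<in>seqs n. p z * (if z = y then c else 1)) = (\<Sum>z\<in>seqs n. p z + (if z = y then p y * (c - 1) else 0))"
    by (intro sum.cong) (auto simp: algebra_simps)
  then show ?thesis using assms by (simp add: sum.distrib sum.delta)
qed

lemma power_cloud_count: "c ^ cloud_count L Y m y = (\<Prod>j<L. if Y (m, j) = y then c else (1::real))"
  unfolding cloud_count_def by (simp add: prod.If_cases Int_def)

text \<open>The counts of a fixed \<open>y\<close> are independent over messages and binomial with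
  \<open>L\<close> trials; this is their joint generating function. Separate arguments
  \<open>c m\<close> allow a message to be switched off by \<open>c m = 1\<close>.\<close>

lemma inst_expect_prod_power:
  assumes W: "stoch_matrix W" and y: "y \<in> seqs n"
  shows "inst_expect W n M L C (\<lambda>Y. \<Prod>m<M. c m ^ cloud_count L Y m y)
    = (\<Prod>m<M. (1 + seq_prob W n (codeword C m) y * (c m - 1)) ^ L)"
proof -
  have "inst_expect W n M L C (\<lambda>Y. \<Prod>m<M. c m ^ cloud_count L Y m y) =
     inst_expect W n M L C (\<lambda>Y. \<Prod>mj\<in>{..<M} \<times> {..<L}. if Y mj = y then c (fst mj) else 1)"
    unfolding power_cloud_count prod.cartesian_product by (simp add: case_prod_unfold)
  also have "\<dots> = (\<Prod>mj\<in>{..<M} \<times> {..<L}. 1 + seq_prob W n (codeword C (fst mj)) y * (c (fst mj) - 1))"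
    by (subst inst_expect_prod) (intro prod.cong refl sum_point_function y sum_seq_prob W)
  also have "\<dots> = (\<Prod>m<M. (1 + seq_prob W n (codeword C m) y * (c m - 1)) ^ L)"
    using prod.cartesian_product[of "\<lambda>m j. 1 + seq_prob W n (codeword C m) y * (c m - 1)" "{..<L}" "{..<M}"]
    by (simp add: case_prod_unfold)
  finally show ?thesis .
qed

lemma inst_expect_power:
  assumes W: "stoch_matrix W" and y: "y \<in> seqs n" and m: "m < M"
  shows "inst_expect W n M L C (\<lambda>Y. c ^ cloud_count L Y m y)
    = (1 + seq_prob W n (codeword C m) y * (c - 1)) ^ L"
proof -
  have "inst_expect W n M L C (\<lambda>Y. \<Prod>m'<M. (if m' = m then c else 1) ^ cloud_count L Y m' y)
     = (\<Prod>m'<M. (if m' = m then (1 + seq_prob W n (codeword C m) y * (c - 1)) ^ L else 1))"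
    unfolding inst_expect_prod_power[OF W y] by (intro prod.cong) auto
  moreover have "(\<Prod>m'<M. (if m' = m then c else 1) ^ cloud_count L Y m' y) = c ^ cloud_count L Y m y" for Y
  proof -
    have "(\<Prod>m'<M. (if m' = m then c else 1) ^ cloud_count L Y m' y)
       = (\<Prod>m'<M. (if m' = m then c ^ cloud_count L Y m y else 1))"
      by (intro prod.cong) auto
    then show ?thesis using m by simp
  qed
  ultimately show ?thesis using m by simp
qed

lemma inst_expect_cloud_count:
  assumes W: "stoch_matrix W" and y: "y \<in> seqs n" and m: "m < M"
  shows "inst_expect W n M L C (\<lambda>Y. real (cloud_count L Y m y)) = L * seq_prob W n (codeword C m) y"
proof -
  have hit: "inst_expect W n M L C (\<lambda>Y. if Y (m, j) = y then 1 else 0) = seq_prob W n (codeword C m) y"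
    if j: "j < L" for j
  proof -
    \<comment> \<open>The indicator of a single hit is written as a product over all cloud
      positions, with factor 1 away from \<open>(m, j)\<close>, to fit
      \<open>inst_expect_prod\<close>.\<close>
    let ?f = "\<lambda>mj z. if mj = (m, j) then if z = y then 1 else 0 else (1::real)"
    have "inst_expect W n M L C (\<lambda>Y. if Y (m, j) = y then 1 else 0) =
        inst_expect W n M L C (\<lambda>Y. \<Prod>mj\<in>{..<M} \<times> {..<L}. ?f mj (Y mj))"
    proof (rule inst_expect_cong)
      fix Y
      have "(\<Prod>mj\<in>{..<M} \<times> {..<L}. ?f mj (Y mj)) =
        (\<Prod>mj\<in>{..<M} \<times> {..<L}. if mj = (m, j) then if Y (m, j) = y then 1 else 0 else 1)"
        by (intro prod.cong) auto
      then show "(if Y (m, j) = y then 1 else 0) = (\<Prod>mj\<in>{..<M} \<times> {..<L}. ?f mj (Y mj))"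
        using m j by (simp add: prod.delta)
    qed
    also have "\<dots> = (\<Prod>mj\<in>{..<M} \<times> {..<L}. if mj = (m, j) then seq_prob W n (codeword C m) y else 1)"
    proof (subst inst_expect_prod, intro prod.cong refl)
      fix mj
      have "(\<Sum>z\<in>seqs n. p z * (if z = y then 1 else 0)) = p y" for p :: "(nat \<Rightarrow> 'b) \<Rightarrow> real"
        using y by (simp add: if_distrib[where f = "\<lambda>t. _ * t"] cong: if_cong)
      then show "(\<Sum>z\<in>seqs n. seq_prob W n (codeword C (fst mj)) z * ?f mj z) =
          (if mj = (m, j) then seq_prob W n (codeword C m) y else 1)"
        by (simp add: sum_seq_prob[OF W])
    qed
    also have "\<dots> = seq_prob W n (codeword C m) y" using m j by (simp add: prod.delta)
    finally show ?thesis .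
  qed
  have "inst_expect W n M L C (\<lambda>Y. real (cloud_count L Y m y)) =
    inst_expect W n M L C (\<lambda>Y. \<Sum>j<L. if Y (m, j) = y then 1 else 0)"
    by (simp add: cloud_count_def sum.If_cases Int_def)
  also have "\<dots> = L * seq_prob W n (codeword C m) y"
    by (simp add: inst_expect_sum hit)
  finally show ?thesis .
qed

section \<open>The exponent and its minimiser\<close>

definition feasible :: "('x::finite \<Rightarrow> 'y::finite \<Rightarrow> real) \<Rightarrow> ('x \<Rightarrow> real) \<Rightarrow> ('x \<Rightarrow> 'y \<Rightarrow> real) \<Rightarrow> bool" where
  "feasible W P U \<longleftrightarrow> prob_distr P \<and> (\<forall>x. prob_distr (U x)) \<and> (\<forall>x y. P x * U x y > 0 \<longrightarrow> W x y > 0)"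

definition exponent :: "('x::finite \<Rightarrow> 'y::finite \<Rightarrow> real) \<Rightarrow> real \<Rightarrow> real \<Rightarrow> ('x \<Rightarrow> real) \<Rightarrow> ('x \<Rightarrow> 'y \<Rightarrow> real) \<Rightarrow> real" where
  "exponent W R K P U = cond_div W P U + pos_part (R - mut_info P U - pos_part (B_term W P U - K))"

definition out_distr :: "('x::finite \<Rightarrow> real) \<Rightarrow> ('x \<Rightarrow> 'y::finite \<Rightarrow> real) \<Rightarrow> 'y \<Rightarrow> real" where
  "out_distr P U y = (\<Sum>x\<in>UNIV. P x * U x y)"

definition out_entropy :: "('x::finite \<Rightarrow> real) \<Rightarrow> ('x \<Rightarrow> 'y::finite \<Rightarrow> real) \<Rightarrow> real" where
  "out_entropy P U = - (\<Sum>y\<in>UNIV. out_distr P U y * ln (out_distr P U y))"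

definition cond_entropy :: "('x::finite \<Rightarrow> real) \<Rightarrow> ('x \<Rightarrow> 'y::finite \<Rightarrow> real) \<Rightarrow> real" where
  "cond_entropy P U = - (\<Sum>x\<in>UNIV. \<Sum>y\<in>UNIV. P x * U x y * ln (U x y))"

lemma E_c_eq: "E_c W R K = Inf {exponent W R K P U | P U. feasible W P U}"
  unfolding E_c_def exponent_def feasible_def by simp

lemma feasibleD:
  assumes "feasible W P U"
  shows "0 \<le> P x" "(\<Sum>x\<in>UNIV. P x) = 1" "0 \<le> U x y" "(\<Sum>y\<in>UNIV. U x y) = 1"
    "0 < P x * U x y \<Longrightarrow> 0 < W x y"
  using assms unfolding feasible_def prob_distr_def by auto

lemma out_distr_ge: "feasible W P U \<Longrightarrow> P x * U x y \<le> out_distr P U y"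
  unfolding out_distr_def
  by (rule member_le_sum[where f = "\<lambda>x. P x * U x y"]) (auto simp: feasibleD)

lemma out_distr_nonneg: "feasible W P U \<Longrightarrow> 0 \<le> out_distr P U y"
  unfolding out_distr_def by (auto intro!: sum_nonneg simp: feasibleD)

lemma out_distr_sum:
  assumes "feasible W P U" shows "(\<Sum>y\<in>UNIV. out_distr P U y) = 1"
proof -
  have "(\<Sum>y\<in>UNIV. out_distr P U y) = (\<Sum>x\<in>UNIV. \<Sum>y\<in>UNIV. P x * U x y)"
    unfolding out_distr_def by (rule sum.swap)
  then show ?thesis using assms by (simp add: sum_distrib_left[symmetric] feasibleD)
qed

lemma out_entropy_alt:
  "out_entropy P U = - (\<Sum>x\<in>UNIV. \<Sum>y\<in>UNIV. P x * U x y * ln (out_distr P U y))"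
proof -
  have "(\<Sum>y\<in>UNIV. out_distr P U y * ln (out_distr P U y)) =
     (\<Sum>y\<in>UNIV. \<Sum>x\<in>UNIV. P x * U x y * ln (out_distr P U y))"
    by (intro sum.cong refl) (simp add: out_distr_def sum_distrib_right)
  also have "\<dots> = (\<Sum>x\<in>UNIV. \<Sum>y\<in>UNIV. P x * U x y * ln (out_distr P U y))"
    by (rule sum.swap)
  finally show ?thesis unfolding out_entropy_def by simp
qed

text \<open>Terms of weight zero vanish on both sides; elsewhere feasibility makes
  \<open>W x y\<close> positive and the logarithm of the quotient splits. No quotient is left, which
  suits both continuity and the comparison of exponents.\<close>

lemma cond_div_eq:
  assumes "feasible W P U" shows "cond_div W P U = B_term W P U - cond_entropy P U"
proof -
  have "P x * U x y * ln (U x y / W x y) = P x * U x y * - ln (W x y) + P x * U x y * ln (U x y)" for x y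
    using feasibleD(1)[OF assms, of x] feasibleD(3,5)[OF assms, of x y]
    by (cases "P x * U x y = 0") (auto simp: ln_div algebra_simps less_le)
  then show ?thesis unfolding cond_div_def B_term_def cond_entropy_def
    by (simp add: sum.distrib[symmetric] del: mult_minus_right)
qed

lemma mut_info_eq:
  assumes "feasible W P U" shows "mut_info P U = out_entropy P U - cond_entropy P U"
proof -
  have "P x * U x y * ln (U x y / out_distr P U y) =
      P x * U x y * ln (U x y) - P x * U x y * ln (out_distr P U y)" for x y
    using feasibleD(1)[OF assms, of x] feasibleD(3,5)[OF assms, of x y] out_distr_ge[OF assms, of x y]
    by (cases "P x * U x y = 0") (auto simp: ln_div algebra_simps less_le mult_le_0_iff)
  then show ?thesis unfolding mut_info_def out_entropy_alt cond_entropy_def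
    by (simp add: sum_subtractf out_distr_def)
qed

section \<open>Compactness and existence of a minimiser\<close>

lemma continuous_on_x_ln_x: "continuous_on {0..} (\<lambda>x::real. x * ln x)"
proof (rule continuous_on_eq_continuous_within[THEN iffD2], rule ballI)
  fix x :: real assume "x \<in> {0..}"
  then consider "x = 0" | "0 < x" by fastforce
  then show "continuous (at x within {0..}) (\<lambda>x. x * ln x)"
  proof cases
    case 1
    \<comment> \<open>At 0 the function takes the value 0 through its first factor, and this is also
      its one-sided limit.\<close>
    have "((\<lambda>x::real. x * ln x) \<longlongrightarrow> 0) (at_right 0)" by real_asymp
    then show ?thesis using 1 by (simp add: continuous_within at_within_Ici_at_right)
  next
    case 2
    then show ?thesis by (intro continuous_intros) auto
  qed
qed

text \<open>Tychonoff's theorem, carried over from the abstract product topology to the function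
  type.\<close>

lemma compact_PiE_UNIV:
  assumes "compact (S :: 'b::topological_space set)"
  shows "compact (PiE (UNIV :: 'a set) (\<lambda>_. S))"
  using compactin_PiE[of "\<lambda>_::'a. euclidean :: 'b topology" UNIV "\<lambda>_. S"] assms
  by (simp add: euclidean_product_topology)

lemma prob_distr_le_1: "prob_distr P \<Longrightarrow> P x \<le> 1"
  using member_le_sum[of x UNIV P] by (auto simp: prob_distr_def)

text \<open>For nonnegative \<open>P\<close> and \<open>U\<close> the support condition says that
  \<open>P x * U x y\<close> is zero wherever \<open>W x y\<close> is not positive. This is an
  equation, hence closed, and the feasible set becomes a closed part of a compact cube.\<close>

lemma compact_feasible:
  fixes W :: "'x::finite \<Rightarrow> 'y::finite \<Rightarrow> real"
  assumes "stoch_matrix W"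
  shows "compact {(P, U). feasible W P U}"
proof -
  let ?S = "PiE (UNIV :: 'x set) (\<lambda>_. {0..1::real}) \<times> PiE (UNIV :: 'x set) (\<lambda>_. PiE (UNIV :: 'y set) (\<lambda>_. {0..1::real}))"
  have c1: "continuous_on UNIV (\<lambda>v :: ('x \<Rightarrow> real) \<times> ('x \<Rightarrow> 'y \<Rightarrow> real). fst v x)" for x
    by (rule continuous_on_product_then_coordinatewise) (rule continuous_on_fst continuous_on_id)+
  have "continuous_on UNIV (\<lambda>v :: ('x \<Rightarrow> real) \<times> ('x \<Rightarrow> 'y \<Rightarrow> real). snd v x)" for x
    by (rule continuous_on_product_then_coordinatewise) (rule continuous_on_snd continuous_on_id)+
  then have c2: "continuous_on UNIV (\<lambda>v :: ('x \<Rightarrow> real) \<times> ('x \<Rightarrow> 'y \<Rightarrow> real). snd v x y)" for x y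
    by (rule continuous_on_product_then_coordinatewise)
  have S: "compact ?S" by (intro compact_Times compact_PiE_UNIV compact_Icc)
  define T1 T2 T3 :: "(('x \<Rightarrow> real) \<times> ('x \<Rightarrow> 'y \<Rightarrow> real)) set"
    where "T1 = {v. (\<Sum>x\<in>UNIV. fst v x) = 1}"
      and "T2 = (\<Inter>x. {v. (\<Sum>y\<in>UNIV. snd v x y) = 1})"
      and "T3 = (\<Inter>(x, y)\<in>{(x, y). \<not> 0 < W x y}. {v. fst v x * snd v x y = 0})"
  have eq: "{(P, U). feasible W P U} = ?S \<inter> (T1 \<inter> T2 \<inter> T3)"
  proof (rule equalityI; rule subsetI)
    fix v assume "v \<in> {(P, U). feasible W P U}"
    then obtain P U where v: "v = (P, U)" and f: "feasible W P U" by auto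
    have "P x * U x y = 0" if "\<not> 0 < W x y" for x y
    proof (rule ccontr)
      assume "P x * U x y \<noteq> 0"
      then have "0 < P x * U x y" using feasibleD(1)[OF f, of x] feasibleD(3)[OF f, of x y] by (simp add: less_le)
      then show False using that feasibleD(5)[OF f] by blast
    qed
    then have "(P, U) \<in> T3" by (auto simp: T3_def)
    moreover have "P x \<le> 1" "U x y \<le> 1" for x y
      using f prob_distr_le_1 by (auto simp: feasible_def)
    ultimately show "v \<in> ?S \<inter> (T1 \<inter> T2 \<inter> T3)"
      unfolding v using feasibleD(1-4)[OF f] by (auto simp: T1_def T2_def PiE_iff)
  next
    fix v assume "v \<in> ?S \<inter> (T1 \<inter> T2 \<inter> T3)"
    then obtain P U where v: "v = (P, U)"
      and PU: "(P, U) \<in> ?S" "(P, U) \<in> T1" "(P, U) \<in> T2" "(P, U) \<in> T3" by (cases v) auto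
    have "0 < W x y" if "0 < P x * U x y" for x y
      using PU(4) that unfolding T3_def by fastforce
    then show "v \<in> {(P, U). feasible W P U}"
      unfolding v using PU(1-3) by (auto simp: feasible_def prob_distr_def PiE_iff T1_def T2_def)
  qed
  have "closed T1" "closed T2"
    unfolding T1_def T2_def
    by (auto intro!: closed_INT closed_Collect_eq continuous_on_sum c1 c2 continuous_on_const)
  moreover have "closed T3"
    unfolding T3_def
    by (intro closed_INT ballI, unfold split_beta)
       (intro closed_Collect_eq continuous_on_mult c1 c2 continuous_on_const)
  ultimately have "closed (T1 \<inter> T2 \<inter> T3)" by (intro closed_Int)
  then show ?thesis unfolding eq by (rule compact_Int_closed[OF S])
qed

lemma feasible_self:
  assumes "stoch_matrix W" "prob_distr P" shows "feasible W P W"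
  unfolding feasible_def
proof (intro conjI allI impI)
  fix x y assume "0 < P x * W x y"
  moreover have "0 \<le> P x" "0 \<le> W x y" using assms by (auto simp: stoch_matrix_def prob_distr_def)
  ultimately show "0 < W x y" by (simp add: less_le)
qed (use assms in \<open>auto simp: stoch_matrix_def prob_distr_def\<close>)

lemma uniform_prob_distr: "prob_distr (\<lambda>_::'x::finite. 1 / real CARD('x))"
  by (simp add: prob_distr_def)

text \<open>A continuous function attains its infimum on the nonempty compact feasible set. The
  minimising \<open>P\<close> later serves as the input distribution for random coding.\<close>

lemma exponent_minimiser:
  fixes W :: "'x::finite \<Rightarrow> 'y::finite \<Rightarrow> real"
  assumes W: "stoch_matrix W"
  obtains P U where "feasible W P U" "E_c W R K = exponent W R K P U"
    "\<And>P' U'. feasible W P' U' \<Longrightarrow> E_c W R K \<le> exponent W R K P' U'"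
proof -
  let ?F = "{(P, U). feasible W P U}"
  let ?xlnx = "\<lambda>t::real. t * ln t"
  define hc where "hc v = - (\<Sum>x\<in>UNIV. \<Sum>y\<in>UNIV. fst v x * ?xlnx (snd v x y))" for v :: "('x \<Rightarrow> real) \<times> ('x \<Rightarrow> 'y \<Rightarrow> real)"
  define ho where "ho v = - (\<Sum>y\<in>UNIV. ?xlnx (\<Sum>x\<in>UNIV. fst v x * snd v x y))" for v :: "('x \<Rightarrow> real) \<times> ('x \<Rightarrow> 'y \<Rightarrow> real)"
  define b where "b v = (\<Sum>x\<in>UNIV. \<Sum>y\<in>UNIV. fst v x * snd v x y * (- ln (W x y)))" for v :: "('x \<Rightarrow> real) \<times> ('x \<Rightarrow> 'y \<Rightarrow> real)"
  \<comment> \<open>\<open>J\<close> agrees with the exponent on feasible pairs, but is built from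
    products and from t ln t, so it is continuous also where some probabilities are zero.\<close>
  define J where "J v = b v - hc v + max 0 (R - (ho v - hc v) - max 0 (b v - K))" for v
  have c1: "continuous_on ?F (\<lambda>v. fst v x)" for x
    by (rule continuous_on_product_then_coordinatewise) (rule continuous_on_fst continuous_on_id)+
  have "continuous_on ?F (\<lambda>v. snd v x)" for x
    by (rule continuous_on_product_then_coordinatewise) (rule continuous_on_snd continuous_on_id)+
  then have c2: "continuous_on ?F (\<lambda>v. snd v x y)" for x y
    by (rule continuous_on_product_then_coordinatewise)
  have xl: "continuous_on ?F (\<lambda>v. ?xlnx (g v))" if "continuous_on ?F g" "\<And>v. v \<in> ?F \<Longrightarrow> 0 \<le> g v" for g
    using continuous_on_compose2[OF continuous_on_x_ln_x that(1)] that(2) by auto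
  have "continuous_on ?F hc"
    unfolding hc_def by (intro continuous_on_minus continuous_on_sum continuous_on_mult c1 xl c2) (auto simp: feasibleD)
  moreover have "continuous_on ?F ho"
    unfolding ho_def by (intro continuous_on_minus continuous_on_sum xl continuous_on_mult c1 c2)
      (auto simp: feasibleD intro!: sum_nonneg)
  moreover have "continuous_on ?F b"
    unfolding b_def by (intro continuous_on_sum continuous_on_mult c1 c2 continuous_on_const)
  ultimately have "continuous_on ?F J"
    unfolding J_def by (intro continuous_intros)
  moreover have "?F \<noteq> {}" using feasible_self[OF W uniform_prob_distr] by auto
  ultimately obtain v where v: "v \<in> ?F" "\<forall>u\<in>?F. J v \<le> J u"
    using continuous_attains_inf[OF compact_feasible[OF W]] by blast
  obtain P U where PU: "v = (P, U)" by force
  have J: "J (P, U) = exponent W R K P U" if "feasible W P U" for P U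
    unfolding exponent_def cond_div_eq[OF that] mut_info_eq[OF that] J_def pos_part_def hc_def ho_def b_def
      B_term_def cond_entropy_def out_entropy_def out_distr_def by (simp add: mult.assoc)
  have f: "feasible W P U" and min: "\<And>P' U'. feasible W P' U' \<Longrightarrow> exponent W R K P U \<le> exponent W R K P' U'"
    using v PU J by auto
  have "E_c W R K = exponent W R K P U"
    unfolding E_c_eq by (rule cInf_eq_minimum) (use f min in auto)
  then show ?thesis using that f min by metis
qed

section \<open>Joint types and the converse\<close>

definition joint_type :: "nat \<Rightarrow> (nat \<Rightarrow> 'x) \<Rightarrow> (nat \<Rightarrow> 'y) \<Rightarrow> 'x \<Rightarrow> 'y \<Rightarrow> nat" where
  "joint_type n x y a b = card {i\<in>{..<n}. x i = a \<and> y i = b}"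

definition joint_types :: "nat \<Rightarrow> ('x::finite \<Rightarrow> 'y::finite \<Rightarrow> nat) set" where
  "joint_types n = PiE UNIV (\<lambda>_. PiE UNIV (\<lambda>_. {..n}))"

definition type_input :: "nat \<Rightarrow> ('x \<Rightarrow> 'y::finite \<Rightarrow> nat) \<Rightarrow> 'x \<Rightarrow> real" where
  "type_input n t a = (\<Sum>b\<in>UNIV. real (t a b)) / real n"

text \<open>On letters of weight zero the conditional distribution is irrelevant; taking the channel
  itself there keeps it stochastic.\<close>

definition type_channel :: "('x \<Rightarrow> 'y::finite \<Rightarrow> real) \<Rightarrow> nat \<Rightarrow> ('x \<Rightarrow> 'y \<Rightarrow> nat) \<Rightarrow> 'x \<Rightarrow> 'y \<Rightarrow> real" where
  "type_channel W n t a b = (if type_input n t a = 0 then W a b else real (t a b) / (real n * type_input n t a))"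

lemma finite_joint_types [simp]: "finite (joint_types n :: ('x::finite \<Rightarrow> 'y::finite \<Rightarrow> nat) set)"
  unfolding joint_types_def by (intro finite_PiE) auto

lemma card_joint_types:
  "card (joint_types n :: ('x::finite \<Rightarrow> 'y::finite \<Rightarrow> nat) set) = (n + 1) ^ (CARD('y) * CARD('x))"
  unfolding joint_types_def by (simp add: card_PiE power_mult)

lemma joint_type_in: "joint_type n x y \<in> joint_types n"
proof -
  have "joint_type n x y a b \<le> n" for a b
    unfolding joint_type_def using card_mono[of "{..<n}" "{i\<in>{..<n}. x i = a \<and> y i = b}"] by auto
  then show ?thesis unfolding joint_types_def by auto
qed

lemma sum_joint_type:
  fixes x :: "nat \<Rightarrow> 'x::finite" and y :: "nat \<Rightarrow> 'y::finite" and f :: "'x \<Rightarrow> 'y \<Rightarrow> real"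
  shows "(\<Sum>i<n. f (x i) (y i)) = (\<Sum>a\<in>UNIV. \<Sum>b\<in>UNIV. real (joint_type n x y a b) * f a b)"
proof -
  have "(\<Sum>i<n. f (x i) (y i)) = (\<Sum>i<n. \<Sum>a\<in>UNIV. \<Sum>b\<in>UNIV. if x i = a \<and> y i = b then f a b else 0)"
  proof (intro sum.cong refl)
    fix i
    have "(\<Sum>a\<in>UNIV. \<Sum>b\<in>UNIV. if x i = a \<and> y i = b then f a b else 0) =
      (\<Sum>a\<in>UNIV. if x i = a then \<Sum>b\<in>UNIV. if y i = b then f a b else 0 else 0)"
      by (intro sum.cong) auto
    then show "f (x i) (y i) = (\<Sum>a\<in>UNIV. \<Sum>b\<in>UNIV. if x i = a \<and> y i = b then f a b else 0)"
      by simp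
  qed
  also have "\<dots> = (\<Sum>a\<in>UNIV. \<Sum>i<n. \<Sum>b\<in>UNIV. if x i = a \<and> y i = b then f a b else 0)"
    by (rule sum.swap)
  also have "\<dots> = (\<Sum>a\<in>UNIV. \<Sum>b\<in>UNIV. \<Sum>i<n. if x i = a \<and> y i = b then f a b else 0)"
    by (intro sum.cong refl sum.swap)
  also have "\<dots> = (\<Sum>a\<in>UNIV. \<Sum>b\<in>UNIV. real (joint_type n x y a b) * f a b)"
    by (intro sum.cong refl) (simp add: joint_type_def sum.If_cases Int_def)
  finally show ?thesis .
qed

lemma joint_type_pos_iff: "0 < joint_type n x y a b \<longleftrightarrow> (\<exists>i<n. x i = a \<and> y i = b)"
  unfolding joint_type_def by (auto simp: card_gt_0_iff)

section \<open>Empirical distributions of a realised joint type\<close>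

context
  fixes W :: "'x::finite \<Rightarrow> 'y::finite \<Rightarrow> real" and n :: nat and t :: "'x \<Rightarrow> 'y \<Rightarrow> nat"
    and P :: "'x \<Rightarrow> real" and U :: "'x \<Rightarrow> 'y \<Rightarrow> real" and x0 :: "nat \<Rightarrow> 'x" and y0 :: "nat \<Rightarrow> 'y"
  assumes W: "stoch_matrix W" and n: "0 < n"
    and P: "P = type_input n t" and U: "U = type_channel W n t"
    and t: "joint_type n x0 y0 = t" and pos: "\<And>i. i < n \<Longrightarrow> 0 < W (x0 i) (y0 i)"
begin

text \<open>A row of weight zero has only zero entries, so the arbitrary choice of channel on it
  does not show in the product.\<close>

lemma type_joint: "P a * U a b = real (t a b) / n"
proof (cases "P a = 0")
  case True
  then have "(\<Sum>b\<in>UNIV. real (t a b)) = 0" using n by (simp add: P type_input_def)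
  then have "real (t a b) = 0" by (subst (asm) sum_nonneg_eq_0_iff) auto
  then show ?thesis using True by simp
next
  case False
  then show ?thesis by (simp add: U type_channel_def P[symmetric])
qed

text \<open>The realising pair \<open>x0\<close>, \<open>y0\<close> supplies both the total
  \<open>n\<close> of the entries and, through its positive transition probabilities, the support
  condition.\<close>

lemma type_feasible: "feasible W P U"
  unfolding feasible_def prob_distr_def
proof (intro conjI allI impI)
  show "0 \<le> P a" for a by (simp add: P type_input_def sum_nonneg)
  have "(\<Sum>a\<in>UNIV. \<Sum>b\<in>UNIV. real (t a b)) = n"
    using sum_joint_type[of "\<lambda>_ _. 1" x0 y0 n] by (simp add: t)
  then show "(\<Sum>a\<in>UNIV. P a) = 1"
    using n by (simp add: P type_input_def sum_divide_distrib[symmetric])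
  show "0 \<le> U a b" for a b
    using W \<open>\<And>a. 0 \<le> P a\<close> by (simp add: U type_channel_def stoch_matrix_def P)
  show "(\<Sum>b\<in>UNIV. U a b) = 1" for a
  proof (cases "P a = 0")
    case True
    then show ?thesis using W by (simp add: U type_channel_def P stoch_matrix_def)
  next
    case False
    have "(\<Sum>b\<in>UNIV. P a * U a b) = P a"
      by (simp add: type_joint sum_divide_distrib[symmetric]) (simp add: P type_input_def)
    then show ?thesis using False by (simp add: sum_distrib_left[symmetric])
  qed
  fix a b assume "0 < P a * U a b"
  then have "0 < t a b" by (simp add: type_joint zero_less_divide_iff)
  then show "0 < W a b" using pos by (auto simp: t[symmetric] joint_type_pos_iff)
qed

text \<open>A product over positions depends on the pair of sequences only through its joint type;
  its logarithm is \<open>n\<close> times the mean of \<open>ln g\<close> under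
  \<open>PU\<close>.\<close>

lemma prod_of_type:
  assumes xy: "joint_type n x y = t" and g: "\<And>a b. 0 < t a b \<Longrightarrow> 0 < g a b"
  shows "(\<Prod>i<n. g (x i) (y i)) = exp (n * (\<Sum>a\<in>UNIV. \<Sum>b\<in>UNIV. P a * U a b * ln (g a b)))"
proof -
  have "0 < g (x i) (y i)" if "i < n" for i
    using g[of "x i" "y i"] that joint_type_pos_iff[of n x y "x i" "y i"] unfolding xy by auto
  then have "(\<Prod>i<n. g (x i) (y i)) = (\<Prod>i<n. exp (ln (g (x i) (y i))))"
    by (intro prod.cong) auto
  also have "\<dots> = exp (\<Sum>i<n. ln (g (x i) (y i)))" by (simp add: exp_sum)
  also have "(\<Sum>i<n. ln (g (x i) (y i))) = n * (\<Sum>a\<in>UNIV. \<Sum>b\<in>UNIV. P a * U a b * ln (g a b))"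
    using n by (simp add: sum_joint_type[where f = "\<lambda>a b. ln (g a b)"] xy type_joint sum_distrib_left)
  finally show ?thesis .
qed

lemma type_PU_pos: "0 < t a b \<Longrightarrow> 0 < P a * U a b"
  using n by (simp add: type_joint)

lemma seq_prob_of_type:
  assumes "joint_type n x y = t"
  shows "seq_prob W n x y = exp (- real n * B_term W P U)"
proof -
  have "seq_prob W n x y = exp (n * (\<Sum>a\<in>UNIV. \<Sum>b\<in>UNIV. P a * U a b * ln (W a b)))"
    unfolding seq_prob_def using feasibleD(5)[OF type_feasible type_PU_pos]
    by (intro prod_of_type assms) auto
  then show ?thesis by (simp add: B_term_def sum_negf)
qed

text \<open>Under the memoryless channel \<open>U\<close> all members of the class have the same
  probability, whose inverse is the claimed bound, and these probabilities add up to at most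
  1.\<close>

lemma card_cond_type_class:
  assumes "A \<subseteq> seqs n" "\<And>y. y \<in> A \<Longrightarrow> joint_type n x y = t"
  shows "real (card A) \<le> exp (n * cond_entropy P U)"
proof -
  have st: "stoch_matrix U" using feasibleD[OF type_feasible] by (auto simp: stoch_matrix_def)
  have "seq_prob U n x y = exp (- real n * cond_entropy P U)" if "y \<in> A" for y
  proof -
    have "0 < U a b" if "0 < t a b" for a b
      using type_PU_pos[OF that] feasibleD(3)[OF type_feasible, of a b] by (auto simp: less_le)
    then have "seq_prob U n x y = exp (n * (\<Sum>a\<in>UNIV. \<Sum>b\<in>UNIV. P a * U a b * ln (U a b)))"
      unfolding seq_prob_def by (intro prod_of_type assms \<open>y \<in> A\<close>) auto
    then show ?thesis by (simp add: cond_entropy_def)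
  qed
  then have "real (card A) * exp (- real n * cond_entropy P U) = (\<Sum>y\<in>A. seq_prob U n x y)" by simp
  also have "\<dots> \<le> (\<Sum>y\<in>seqs n. seq_prob U n x y)"
    using assms(1) by (intro sum_mono2) (auto simp: seq_prob_nonneg[OF st])
  also have "\<dots> = 1" by (rule sum_seq_prob[OF st])
  finally show ?thesis by (simp add: exp_minus field_simps)
qed

text \<open>The same counting with the output distribution as a channel \<open>?q\<close> that
  ignores its input. Each \<open>y\<close> may come with its own \<open>x\<close>; the fixed
  \<open>x0\<close> is then a common dummy input.\<close>

lemma card_out_type_class:
  assumes "A \<subseteq> seqs n" "\<And>y. y \<in> A \<Longrightarrow> \<exists>x. joint_type n x y = t"
  shows "real (card A) \<le> exp (n * out_entropy P U)"
proof -
  let ?q = "\<lambda>a. out_distr P U"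
  have st: "stoch_matrix (?q :: 'x \<Rightarrow> 'y \<Rightarrow> real)"
    using out_distr_nonneg[OF type_feasible] out_distr_sum[OF type_feasible] by (auto simp: stoch_matrix_def)
  have "seq_prob ?q n x0 y = exp (- real n * out_entropy P U)" if y: "y \<in> A" for y
  proof -
    obtain x where x: "joint_type n x y = t" using assms(2)[OF y] by blast
    have "0 < ?q a b" if "0 < t a b" for a b
      using type_PU_pos[OF that] out_distr_ge[OF type_feasible, of a b] by linarith
    then have "seq_prob ?q n x y = exp (n * (\<Sum>a\<in>UNIV. \<Sum>b\<in>UNIV. P a * U a b * ln (?q a b)))"
      unfolding seq_prob_def by (intro prod_of_type[OF x]) auto
    then show ?thesis by (simp add: out_entropy_alt seq_prob_def)
  qed
  then have "real (card A) * exp (- real n * out_entropy P U) = (\<Sum>y\<in>A. seq_prob ?q n x0 y)" by simp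
  also have "\<dots> \<le> (\<Sum>y\<in>seqs n. seq_prob ?q n x0 y)"
    using assms(1) by (intro sum_mono2) (auto simp: seq_prob_nonneg[OF st])
  also have "\<dots> = 1" by (rule sum_seq_prob[OF st])
  finally show ?thesis by (simp add: exp_minus field_simps)
qed

end

section \<open>The maximal count within one joint type\<close>

definition typed_msgs :: "nat \<Rightarrow> nat \<Rightarrow> (nat \<times> nat \<Rightarrow> 'x) \<Rightarrow> ('x \<Rightarrow> 'y \<Rightarrow> nat) \<Rightarrow> (nat \<Rightarrow> 'y) \<Rightarrow> nat set" where
  "typed_msgs n M C t y = {m\<in>{..<M}. joint_type n (codeword C m) y = t}"

text \<open>Inserting 0 gives an empty class the value 0 and keeps \<open>Max\<close> off the empty
  set.\<close>

definition typed_max :: "nat \<Rightarrow> nat \<Rightarrow> nat \<Rightarrow> (nat \<times> nat \<Rightarrow> 'x) \<Rightarrow> ('x \<Rightarrow> 'y \<Rightarrow> nat) \<Rightarrow> (nat \<times> nat \<Rightarrow> nat \<Rightarrow> 'y) \<Rightarrow> (nat \<Rightarrow> 'y) \<Rightarrow> nat" where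
  "typed_max n M L C t Y y = Max (insert 0 ((\<lambda>m. cloud_count L Y m y) ` typed_msgs n M C t y))"

lemma finite_typed_msgs [simp]: "finite (typed_msgs n M C t y)"
  by (simp add: typed_msgs_def)

lemma max_count_le_sum_typed_max:
  fixes C :: "nat \<times> nat \<Rightarrow> 'x::finite" and y :: "nat \<Rightarrow> 'y::finite"
  assumes "0 < M"
  shows "max_count M L Y y \<le> (\<Sum>t\<in>joint_types n. typed_max n M L C t Y y)"
proof -
  obtain m where m: "m < M" "max_count M L Y y = cloud_count L Y m y"
    using max_count_attained[OF assms] by blast
  let ?t = "joint_type n (codeword C m) y"
  have "cloud_count L Y m y \<le> typed_max n M L C ?t Y y"
    unfolding typed_max_def using m by (intro Max_ge) (auto simp: typed_msgs_def)
  also have "\<dots> \<le> (\<Sum>t\<in>joint_types n. typed_max n M L C t Y y)"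
    by (rule member_le_sum) (auto simp: joint_type_in)
  finally show ?thesis using m by simp
qed

lemma typed_max_le_sum: "typed_max n M L C t Y y \<le> (\<Sum>m\<in>typed_msgs n M C t y. cloud_count L Y m y)"
  unfolding typed_max_def by (intro Max.boundedI) (auto intro: member_le_sum)

text \<open>The maximum is one of the counts, and its exponential is dominated by the sum over the
  class. The right side is linear in quantities whose expectation is a generating function.\<close>

lemma typed_max_le_exp:
  assumes "0 \<le> \<tau>"
  shows "real (typed_max n M L C t Y y) \<le>
     \<tau> + exp (- \<tau>) * (\<Sum>m\<in>typed_msgs n M C t y. exp 1 ^ cloud_count L Y m y)"
proof -
  let ?S = "typed_msgs n M C t y"
  have nn: "0 \<le> exp (- \<tau>) * (\<Sum>m\<in>?S. exp 1 ^ cloud_count L Y m y)"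
    by (intro mult_nonneg_nonneg sum_nonneg) auto
  have "typed_max n M L C t Y y \<in> insert 0 ((\<lambda>m. cloud_count L Y m y) ` ?S)"
    unfolding typed_max_def by (rule Max_in) auto
  then consider "typed_max n M L C t Y y = 0" | m where "m \<in> ?S" "typed_max n M L C t Y y = cloud_count L Y m y"
    by auto
  then show ?thesis
  proof cases
    case 1
    then show ?thesis using nn assms by simp
  next
    case 2
    let ?N = "real (cloud_count L Y m y)"
    have "?N \<le> \<tau> + exp (?N - \<tau>)" using exp_ge_add_one_self[of "?N - \<tau>"] by linarith
    also have "exp (?N - \<tau>) = exp (- \<tau>) * exp 1 ^ cloud_count L Y m y"
      by (simp add: exp_diff exp_minus exp_of_nat_mult[symmetric] field_simps)
    also have "\<dots> \<le> exp (- \<tau>) * (\<Sum>m\<in>?S. exp 1 ^ cloud_count L Y m y)"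
      using 2 by (intro mult_left_mono member_le_sum) auto
    finally show ?thesis using 2 by simp
  qed
qed

text \<open>Double counting of pairs of message and received vector; the right side consists of
  conditional type classes, whose size is bounded above.\<close>

lemma sum_card_typed_msgs:
  fixes C :: "nat \<times> nat \<Rightarrow> 'x::finite" and t :: "'x \<Rightarrow> 'y::finite \<Rightarrow> nat"
  shows "(\<Sum>y\<in>seqs n. card (typed_msgs n M C t y)) =
    (\<Sum>m<M. card {y\<in>seqs n. joint_type n (codeword C m) y = t})"
proof -
  have "(\<Sum>y\<in>seqs n. card (typed_msgs n M C t y)) =
      (\<Sum>y\<in>seqs n. \<Sum>m<M. if joint_type n (codeword C m) y = t then 1 else 0)"
    by (simp add: typed_msgs_def sum.If_cases Int_def)
  also have "\<dots> = (\<Sum>m<M. \<Sum>y\<in>seqs n. if joint_type n (codeword C m) y = t then 1 else 0)"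
    by (rule sum.swap)
  also have "\<dots> = (\<Sum>m<M. card {y\<in>seqs n. joint_type n (codeword C m) y = t})"
    by (simp add: sum.If_cases Int_def)
  finally show ?thesis .
qed

lemma typed_expect_le_sum:
  assumes W: "stoch_matrix W" and y: "y \<in> seqs n"
  shows "inst_expect W n M L C (\<lambda>Y. real (typed_max n M L C t Y y)) \<le>
    (\<Sum>m\<in>typed_msgs n M C t y. L * seq_prob W n (codeword C m) y)"
proof -
  have "inst_expect W n M L C (\<lambda>Y. real (typed_max n M L C t Y y)) \<le>
     inst_expect W n M L C (\<lambda>Y. \<Sum>m\<in>typed_msgs n M C t y. real (cloud_count L Y m y))"
    using typed_max_le_sum[of n M L C t _ y]
    by (intro inst_expect_mono[OF W]) (simp flip: of_nat_sum)
  also have "\<dots> = (\<Sum>m\<in>typed_msgs n M C t y. L * seq_prob W n (codeword C m) y)"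
    unfolding inst_expect_sum
    by (intro sum.cong refl inst_expect_cloud_count[OF W y]) (auto simp: typed_msgs_def)
  finally show ?thesis .
qed

text \<open>From \<open>N \<le> \<tau> + exp (N - \<tau>)\<close> for each count \<open>N\<close>, with \<open>\<tau>\<close> balancing the union bound over messages.\<close>

lemma typed_expect_le_ln:
  assumes W: "stoch_matrix W" and y: "y \<in> seqs n" and M: "1 \<le> M"
    and p: "\<And>m. m \<in> typed_msgs n M C t y \<Longrightarrow> seq_prob W n (codeword C m) y = p" and "0 \<le> p"
  shows "inst_expect W n M L C (\<lambda>Y. real (typed_max n M L C t Y y)) \<le> ln M + 2 * real L * p + 1"
proof -
  let ?S = "typed_msgs n M C t y"
  define \<tau> where "\<tau> = ln M + 2 * real L * p"
  have \<tau>: "0 \<le> \<tau>" using M \<open>0 \<le> p\<close> by (simp add: \<tau>_def)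
  have "inst_expect W n M L C (\<lambda>Y. real (typed_max n M L C t Y y)) \<le>
    inst_expect W n M L C (\<lambda>Y. \<tau> + exp (- \<tau>) * (\<Sum>m\<in>?S. exp 1 ^ cloud_count L Y m y))"
    by (intro inst_expect_mono[OF W] typed_max_le_exp \<tau>)
  also have "\<dots> = \<tau> + exp (- \<tau>) * (\<Sum>m\<in>?S. (1 + seq_prob W n (codeword C m) y * (exp 1 - 1)) ^ L)"
    unfolding inst_expect_add inst_expect_const[OF W] inst_expect_cmult inst_expect_sum
    by (intro arg_cong2[where f = "(+)"] arg_cong2[where f = "(*)"] sum.cong refl inst_expect_power[OF W y])
       (auto simp: typed_msgs_def)
  also have "(\<Sum>m\<in>?S. (1 + seq_prob W n (codeword C m) y * (exp 1 - 1)) ^ L) = card ?S * (1 + p * (exp 1 - 1)) ^ L"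
    by (simp add: p)
  also have "\<dots> \<le> M * exp (2 * real L * p)"
  proof (intro mult_mono)
    show "real (card ?S) \<le> real M"
      using card_mono[of "{..<M}" ?S] by (auto simp: typed_msgs_def)
    \<comment> \<open>This is the source of the 2 in \<open>\<tau>\<close>: since
      \<open>exp 1 \<le> 3\<close>, the binomial moment is at most
      \<open>exp (2 * real L * p)\<close>.\<close>
    have "1 + p * (exp 1 - 1) \<le> 1 + 2 * p"
      using mult_left_mono[of "exp 1 - 1" 2 p] exp_le \<open>0 \<le> p\<close> by simp
    also have "\<dots> \<le> exp (2 * p)" using exp_ge_add_one_self[of "2 * p"] by simp
    finally have "(1 + p * (exp 1 - 1)) ^ L \<le> exp (2 * p) ^ L"
      using \<open>0 \<le> p\<close> by (intro power_mono add_nonneg_nonneg mult_nonneg_nonneg) auto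
    also have "\<dots> = exp (2 * real L * p)" by (simp add: exp_of_nat_mult[symmetric] mult_ac)
    finally show "(1 + p * (exp 1 - 1)) ^ L \<le> exp (2 * real L * p)" .
  qed (use \<open>0 \<le> p\<close> in \<open>auto intro!: zero_le_power add_nonneg_nonneg mult_nonneg_nonneg\<close>)
  also have "M * exp (2 * real L * p) = exp \<tau>" using M by (simp add: \<tau>_def exp_add)
  also have "exp (- \<tau>) * exp \<tau> = 1" by (simp flip: exp_add)
  finally show ?thesis by (simp add: \<tau>_def mult_left_mono)
qed

lemma typed_max_empty: "typed_msgs n M C t y = {} \<Longrightarrow> typed_max n M L C t Y y = 0"
  by (simp add: typed_max_def)

text \<open>Trades the growth rate \<open>pos_part (K - B)\<close> of the counts for the term
  \<open>pos_part (B - K)\<close> of the exponent.\<close>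

lemma pos_part_diff: "pos_part (a - b) = a - b + pos_part (b - a)"
  by (simp add: pos_part_def)

text \<open>Two bounds on one total. Means summed over conditional type classes give the exponent
  \<open>D\<close>; the logarithmic bound, taken over the received vectors of the right output type,
  gives \<open>D + (R - I - pos_part (B - K))\<close>. The better one has exponent at least
  \<open>E_c\<close>, because the empirical pair is feasible.\<close>

lemma typed_expect_total:
  fixes W :: "'x::finite \<Rightarrow> 'y::finite \<Rightarrow> real"
  assumes W: "stoch_matrix W" and R: "0 < R" and K: "0 < K" and n: "0 < n"
    and M: "M = num_msgs R n" and L: "L = num_msgs K n"
  shows "(\<Sum>y\<in>seqs n. inst_expect W n M L C (\<lambda>Y. real (typed_max n M L C t Y y)))
    \<le> 4 * (n * R + 3) * (real M * real L) * exp (- real n * E_c W R K)"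
    (is "?lhs \<le> ?rhs")
\<comment> \<open>If all probabilities in the class vanish, so does the total. Otherwise one pair of
  positive probability makes the empirical pair feasible.\<close>
proof (cases "\<exists>y\<in>seqs n. \<exists>m\<in>typed_msgs n M C t y. seq_prob W n (codeword C m) y \<noteq> 0")
  case False
  then have "inst_expect W n M L C (\<lambda>Y. real (typed_max n M L C t Y y)) \<le> 0" if "y \<in> seqs n" for y
    using typed_expect_le_sum[OF W that, of M L C t] that by simp
  then have "?lhs \<le> 0" by (intro sum_nonpos)
  also have "0 \<le> ?rhs" using R by simp
  finally show ?thesis .
next
  case True
  then obtain y0 m0 where t: "joint_type n (codeword C m0) y0 = t"
    and p0: "seq_prob W n (codeword C m0) y0 \<noteq> 0" by (auto simp: typed_msgs_def)
  have pos: "0 < W (codeword C m0 i) (y0 i)" if "i < n" for i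
    using p0 that W by (auto simp: seq_prob_def stoch_matrix_def less_le)
  define P where "P = type_input n t"
  define U where "U = type_channel W n t"
  note type_facts = W n P_def U_def t pos
  have f: "feasible W P U" by (rule type_feasible[OF type_facts])
  define D B I Hc Ho where "D = cond_div W P U" and "B = B_term W P U" and "I = mut_info P U"
    and "Hc = cond_entropy P U" and "Ho = out_entropy P U"
  have D: "D = B - Hc" and I: "I = Ho - Hc"
    using cond_div_eq[OF f] mut_info_eq[OF f] by (simp_all add: D_def B_def I_def Hc_def Ho_def)
  define p where "p = exp (- real n * B)"
  have p: "seq_prob W n (codeword C m) y = p" if "m \<in> typed_msgs n M C t y" for m y
    unfolding p_def B_def using that by (intro seq_prob_of_type[OF type_facts]) (auto simp: typed_msgs_def)
  have M1: "1 \<le> M" "real M \<le> exp (n * R)" "exp (n * R) / 2 \<le> real M"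
    using num_msgs_bounds[OF R, of n] M by auto
  have L1: "1 \<le> L" "real L \<le> exp (n * K)" "exp (n * K) / 2 \<le> real L"
    using num_msgs_bounds[OF K, of n] L by auto
  let ?e = "\<lambda>y. inst_expect W n M L C (\<lambda>Y. real (typed_max n M L C t Y y))"
  have c: "1 \<le> 4 * (n * R + 3)" using R by (simp add: add_increasing)
  have 1: "?lhs \<le> 4 * (n * R + 3) * (real M * real L) * exp (- real n * D)"
  proof -
    have "?lhs \<le> (\<Sum>y\<in>seqs n. real (card (typed_msgs n M C t y)) * (L * p))"
      using typed_expect_le_sum[OF W, of _ n M L C t] by (intro sum_mono) (simp add: p)
    also have "\<dots> = real (\<Sum>y\<in>seqs n. card (typed_msgs n M C t y)) * (L * p)"
      by (simp add: sum_distrib_right)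
    also have "\<dots> \<le> (M * exp (n * Hc)) * (L * p)"
    proof (intro mult_right_mono)
      have "real (\<Sum>y\<in>seqs n. card (typed_msgs n M C t y)) =
         (\<Sum>m<M. real (card {y\<in>seqs n. joint_type n (codeword C m) y = t}))"
        by (simp add: sum_card_typed_msgs)
      also have "\<dots> \<le> (\<Sum>m<M. exp (n * Hc))"
        unfolding Hc_def by (intro sum_mono card_cond_type_class[OF type_facts]) auto
      finally show "real (\<Sum>y\<in>seqs n. card (typed_msgs n M C t y)) \<le> M * exp (n * Hc)" by simp
    qed (simp add: p_def)
    also have "\<dots> = 1 * (real M * real L) * exp (- real n * D)"
      by (simp add: p_def D exp_add[symmetric] algebra_simps)
    also have "\<dots> \<le> 4 * (n * R + 3) * (real M * real L) * exp (- real n * D)"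
      using c by (intro mult_right_mono) auto
    finally show ?thesis .
  qed
  have 2: "?lhs \<le> 4 * (n * R + 3) * (real M * real L) * exp (- real n * (D + (R - I - pos_part (B - K))))"
  proof -
    let ?A = "{y\<in>seqs n. typed_msgs n M C t y \<noteq> {}}"
    have lnM: "ln M \<le> n * R" using M1 by (metis ln_exp ln_le_cancel_iff exp_gt_zero of_nat_0_less_iff less_le_trans zero_less_one)
    have "?lhs = (\<Sum>y\<in>?A. ?e y)"
      by (rule sum.mono_neutral_right) (auto simp: typed_max_empty inst_expect_const[OF W])
    also have "\<dots> \<le> (\<Sum>y\<in>?A. ln M + 2 * real L * p + 1)"
    proof (rule sum_mono)
      fix y assume "y \<in> ?A"
      then have "y \<in> seqs n" by simp
      then show "?e y \<le> ln M + 2 * real L * p + 1"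
        by (rule typed_expect_le_ln[OF W _ M1(1) p]) (simp_all add: p_def)
    qed
    also have "\<dots> = real (card ?A) * (ln M + 2 * real L * p + 1)" by simp
    also have "\<dots> \<le> exp (n * Ho) * ((n * R + 3) * exp (n * pos_part (K - B)))"
    proof (intro mult_mono)
      show "real (card ?A) \<le> exp (n * Ho)"
        unfolding Ho_def by (intro card_out_type_class[OF type_facts]) (auto simp: typed_msgs_def)
      have "L * p \<le> exp (n * K) * p" using L1 by (intro mult_right_mono) (auto simp: p_def)
      also have "\<dots> = exp (n * (K - B))" by (simp add: p_def exp_add[symmetric] algebra_simps)
      also have "\<dots> \<le> exp (n * pos_part (K - B))" by (simp add: pos_part_def mult_left_mono)
      finally have "L * p \<le> exp (n * pos_part (K - B))" .
      moreover have e1: "1 \<le> exp (n * pos_part (K - B))" by (simp add: pos_part_def)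
      moreover have "n * R \<le> n * R * exp (n * pos_part (K - B))"
        using mult_left_mono[OF e1, of "n * R"] R by simp
      ultimately have "ln M + 2 * real L * p + 1 \<le> n * R * exp (n * pos_part (K - B)) + 3 * exp (n * pos_part (K - B))"
        using lnM by linarith
      then show "ln M + 2 * real L * p + 1 \<le> (n * R + 3) * exp (n * pos_part (K - B))"
        by (simp only: distrib_right)
      show "0 \<le> ln M + 2 * real L * p + 1" using M1 by (simp add: p_def add_nonneg_nonneg)
    qed auto
    \<comment> \<open>The conditional entropy cancels in \<open>D - I = B - Ho\<close>, so
      \<open>Ho + pos_part (K - B)\<close> equals \<open>R + K\<close> minus the exponent on the
      right.\<close>
    also have "\<dots> = (n * R + 3) * (exp (n * R) * exp (n * K)) * exp (- real n * (D + (R - I - pos_part (B - K))))"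
      unfolding D I pos_part_diff[of K B] by (simp add: mult.assoc exp_add[symmetric]) (simp add: algebra_simps)
    \<comment> \<open>The 4 undoes the two floors in \<open>M\<close> and \<open>L\<close>.\<close>
    also have "\<dots> \<le> (n * R + 3) * (4 * (real M * real L)) * exp (- real n * (D + (R - I - pos_part (B - K))))"
    proof -
      have "(exp (n * R) / 2) * (exp (n * K) / 2) \<le> real M * real L"
        using M1 L1 by (intro mult_mono) auto
      then show ?thesis using R by (intro mult_right_mono mult_left_mono) auto
    qed
    finally show ?thesis by (simp add: mult_ac)
  qed
  have "E_c W R K \<le> exponent W R K P U"
    using exponent_minimiser[OF W, of R K] f by metis
  also have "exponent W R K P U = D + pos_part (R - I - pos_part (B - K))"
    by (simp add: exponent_def D_def I_def B_def)
  \<comment> \<open>The larger of the two exponents is \<open>D\<close> plus a positive part, which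
    is exactly the form of \<open>exponent\<close>.\<close>
  finally have E: "E_c W R K \<le> max D (D + (R - I - pos_part (B - K)))"
    by (auto simp: pos_part_def max_def split: if_splits)
  define D' where "D' = max D (D + (R - I - pos_part (B - K)))"
  have "?lhs \<le> 4 * (n * R + 3) * (real M * real L) * exp (- real n * D')"
    using 1 2 by (auto simp: D'_def max_def)
  also have "\<dots> \<le> ?rhs"
    using E R unfolding D'_def[symmetric] by (intro mult_left_mono) (auto intro!: mult_left_mono)
  finally show ?thesis .
qed

text \<open>Every joint type obeys the same bound, and there are polynomially many of them. The
  bound does not depend on the codebook.\<close>

lemma correct_prob_le:
  fixes W :: "'x::finite \<Rightarrow> 'y::finite \<Rightarrow> real"
  assumes W: "stoch_matrix W" and R: "0 < R" and K: "0 < K" and n: "0 < n"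
  shows "1 - err_prob W R K n C \<le>
    real ((n + 1) ^ (CARD('y) * CARD('x))) * (4 * (n * R + 3)) * exp (- real n * E_c W R K)"
proof -
  define M where "M = num_msgs R n"
  define L where "L = num_msgs K n"
  have ge1: "1 \<le> M" "1 \<le> L" using num_msgs_bounds(1) R K by (auto simp: M_def L_def)
  have "(\<Sum>y\<in>seqs n. inst_expect W n M L C (\<lambda>Y. real (max_count M L Y y))) \<le>
     (\<Sum>y\<in>seqs n. inst_expect W n M L C (\<lambda>Y. \<Sum>t\<in>joint_types n. real (typed_max n M L C t Y y)))"
    using max_count_le_sum_typed_max[of M L _ _ n C] ge1
    by (intro sum_mono inst_expect_mono[OF W]) (simp flip: of_nat_sum)
  also have "\<dots> = (\<Sum>t\<in>joint_types n. \<Sum>y\<in>seqs n. inst_expect W n M L C (\<lambda>Y. real (typed_max n M L C t Y y)))"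
    unfolding inst_expect_sum by (rule sum.swap)
  also have "\<dots> \<le> (\<Sum>t\<in>(joint_types n :: ('x \<Rightarrow> 'y \<Rightarrow> nat) set). 4 * (n * R + 3) * (real M * real L) * exp (- real n * E_c W R K))"
    by (intro sum_mono typed_expect_total[OF W R K n M_def L_def])
  also have "\<dots> = (real ((n + 1) ^ (CARD('y) * CARD('x))) * (4 * (n * R + 3)) * exp (- real n * E_c W R K)) * (real M * real L)"
    by (simp add: card_joint_types)
  finally show ?thesis
    unfolding correct_prob_eq[OF W R K] M_def[symmetric] L_def[symmetric] using ge1 by (simp add: divide_le_eq)
qed

section \<open>Random coding\<close>

text \<open>The moment generating function equals 1 at 0 and its derivative there is the mean, which
  is negative; so it drops below 1 just to the right of 0.\<close>

lemma exp_tilt_less_1: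
  fixes w g :: "'a \<Rightarrow> real"
  assumes "(\<Sum>a\<in>A. w a) = 1" "(\<Sum>a\<in>A. w a * g a) < 0"
  obtains s where "0 < s" "(\<Sum>a\<in>A. w a * exp (s * g a)) < 1"
proof -
  have "((\<lambda>s. \<Sum>a\<in>A. w a * exp (s * g a)) has_real_derivative (\<Sum>a\<in>A. w a * g a)) (at 0)"
    by (auto intro!: derivative_eq_intros sum.cong)
  from DERIV_neg_dec_right[OF this assms(2)]
  obtain d where d: "0 < d" "\<And>h. 0 < h \<Longrightarrow> h < d \<Longrightarrow> (\<Sum>a\<in>A. w a * exp (h * g a)) < 1"
    using assms(1) by auto
  show ?thesis using that[of "d / 2"] d(1) d(2)[of "d / 2"] by simp
qed

lemma sum_seqs_prod2:
  fixes h :: "'x::finite \<Rightarrow> 'y::finite \<Rightarrow> real"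
  shows "(\<Sum>x\<in>seqs n. \<Sum>y\<in>seqs n. \<Prod>i<n. h (x i) (y i)) = (\<Sum>a\<in>UNIV. \<Sum>b\<in>UNIV. h a b) ^ n"
proof -
  have "(\<Sum>x\<in>seqs n. \<Sum>y\<in>seqs n. \<Prod>i<n. h (x i) (y i)) = (\<Sum>x\<in>seqs n. \<Prod>i<n. \<Sum>b\<in>UNIV. h (x i) b)"
    by (intro sum.cong refl sum_seqs_prod[where f = "\<lambda>i. h (_ i)"])
  also have "\<dots> = (\<Sum>a\<in>UNIV. \<Sum>b\<in>UNIV. h a b) ^ n"
    using sum_seqs_prod[of "\<lambda>i a. \<Sum>b\<in>UNIV. h a b" n] by simp
  finally show ?thesis .
qed

text \<open>The slack \<open>\<delta>\<close> makes the mean of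
  \<open>f - (\<mu> + \<delta>)\<close> negative, so a small exponential tilt has moment
  \<open>\<rho> < 1\<close>. The tilt dominates the indicator and factorises over the letters, with
  one \<open>\<rho>\<close> for all \<open>n\<close>.\<close>

lemma chernoff_bound:
  fixes w f :: "'x::finite \<Rightarrow> 'y::finite \<Rightarrow> real"
  assumes w: "\<And>a b. 0 \<le> w a b" "(\<Sum>a\<in>UNIV. \<Sum>b\<in>UNIV. w a b) = 1" and "0 < \<delta>"
    and mean: "(\<Sum>a\<in>UNIV. \<Sum>b\<in>UNIV. w a b * f a b) = \<mu>"
  obtains \<rho> where "0 \<le> \<rho>" "\<rho> < 1"
    "\<And>n. (\<Sum>x\<in>seqs n. \<Sum>y\<in>seqs n. (\<Prod>i<n. w (x i) (y i)) *
        (if n * (\<mu> + \<delta>) < (\<Sum>i<n. f (x i) (y i)) then 1 else 0)) \<le> \<rho> ^ n"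
proof -
  have "(\<Sum>(a, b)\<in>UNIV \<times> UNIV. w a b) = 1" "(\<Sum>(a, b)\<in>UNIV \<times> UNIV. w a b * (f a b - (\<mu> + \<delta>))) < 0"
    unfolding sum.cartesian_product[symmetric] using w(2) mean \<open>0 < \<delta>\<close>
    by (simp_all add: right_diff_distrib sum_subtractf sum_distrib_right[symmetric])
  then obtain s where s: "0 < s" "(\<Sum>(a, b)\<in>UNIV \<times> UNIV. w a b * exp (s * (f a b - (\<mu> + \<delta>)))) < 1"
    using exp_tilt_less_1[where A = "UNIV \<times> UNIV" and w = "\<lambda>(a, b). w a b" and g = "\<lambda>(a, b). f a b - (\<mu> + \<delta>)"]
    unfolding case_prod_unfold by blast
  define \<rho> where "\<rho> = (\<Sum>a\<in>UNIV. \<Sum>b\<in>UNIV. w a b * exp (s * (f a b - (\<mu> + \<delta>))))"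
  have "(\<Sum>x\<in>seqs n. \<Sum>y\<in>seqs n. (\<Prod>i<n. w (x i) (y i)) *
        (if n * (\<mu> + \<delta>) < (\<Sum>i<n. f (x i) (y i)) then 1 else 0)) \<le> \<rho> ^ n" for n
  proof -
    have "(if n * (\<mu> + \<delta>) < (\<Sum>i<n. f (x i) (y i)) then 1 else 0) \<le> (\<Prod>i<n. exp (s * (f (x i) (y i) - (\<mu> + \<delta>))))"
      for x :: "nat \<Rightarrow> 'x" and y :: "nat \<Rightarrow> 'y"
    proof -
      have "(\<Prod>i<n. exp (s * (f (x i) (y i) - (\<mu> + \<delta>)))) = exp (s * ((\<Sum>i<n. f (x i) (y i)) - n * (\<mu> + \<delta>)))"
        by (simp add: exp_sum[symmetric] sum_distrib_left[symmetric] sum_subtractf)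
      then show ?thesis using s(1) by auto
    qed
    then have "(\<Sum>x\<in>seqs n. \<Sum>y\<in>seqs n. (\<Prod>i<n. w (x i) (y i)) *
        (if n * (\<mu> + \<delta>) < (\<Sum>i<n. f (x i) (y i)) then 1 else 0)) \<le>
      (\<Sum>x\<in>seqs n. \<Sum>y\<in>seqs n. (\<Prod>i<n. w (x i) (y i)) * (\<Prod>i<n. exp (s * (f (x i) (y i) - (\<mu> + \<delta>)))))"
      by (intro sum_mono mult_left_mono prod_nonneg) (auto simp: w)
    also have "\<dots> = \<rho> ^ n"
      unfolding \<rho>_def prod.distrib[symmetric] by (rule sum_seqs_prod2)
    finally show ?thesis .
  qed
  moreover have "0 \<le> \<rho>" unfolding \<rho>_def by (intro sum_nonneg mult_nonneg_nonneg) (auto simp: w)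
  moreover have "\<rho> < 1" using s(2) unfolding \<rho>_def sum.cartesian_product[symmetric] .
  ultimately show ?thesis using that by blast
qed

text \<open>Only one-sided bounds: from below on the channel probability, from above on the output
  probability and on the information density. The positivity clause makes all the logarithms
  genuine.\<close>

definition typical :: "('x::finite \<Rightarrow> 'y::finite \<Rightarrow> real) \<Rightarrow> ('x \<Rightarrow> real) \<Rightarrow> ('x \<Rightarrow> 'y \<Rightarrow> real) \<Rightarrow> real \<Rightarrow> nat
    \<Rightarrow> (nat \<Rightarrow> 'x) \<Rightarrow> (nat \<Rightarrow> 'y) \<Rightarrow> bool" where
  "typical W P U \<delta> n x y \<longleftrightarrow> (\<forall>i<n. 0 < P (x i) * U (x i) (y i)) \<and>
     (\<Sum>i<n. - ln (W (x i) (y i))) \<le> n * (B_term W P U + \<delta>) \<and>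
     (\<Sum>i<n. ln (out_distr P U (y i))) \<le> n * (- out_entropy P U + \<delta>) \<and>
     (\<Sum>i<n. ln (U (x i) (y i)) - ln (out_distr P U (y i))) \<le> n * (mut_info P U + \<delta>)"

text \<open>Each of the three inequalities fails with exponentially small probability under
  \<open>PU\<close>, so by the union bound at least half of the mass is eventually typical.\<close>

lemma typical_mass:
  fixes W :: "'x::finite \<Rightarrow> 'y::finite \<Rightarrow> real"
  assumes f: "feasible W P U" and \<delta>: "0 < \<delta>"
  shows "\<forall>\<^sub>F n in sequentially. 1 / 2 \<le> (\<Sum>x\<in>seqs n. \<Sum>y\<in>seqs n.
      (\<Prod>i<n. P (x i) * U (x i) (y i)) * (if typical W P U \<delta> n x y then 1 else 0))"
proof -
  let ?w = "\<lambda>a b. P a * U a b"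
  let ?Q = "\<lambda>n x y. \<Prod>i<n. P (x i) * U (x i) (y i)"
  have w: "0 \<le> ?w a b" "(\<Sum>a\<in>UNIV. \<Sum>b\<in>UNIV. ?w a b) = 1" for a b
    using feasibleD[OF f] by (simp_all add: sum_distrib_left[symmetric])
  let ?bad = "\<lambda>n g \<mu> x y. if real n * (\<mu> + \<delta>) < (\<Sum>i<n. g (x i) (y i)) then 1 else (0::real)"
  define f1 f2 f3 where "f1 = (\<lambda>a b. - ln (W a b))" and "f2 = (\<lambda>(a::'x) b. ln (out_distr P U b))"
    and "f3 = (\<lambda>a b. ln (U a b) - ln (out_distr P U b))"
  obtain \<rho>1 where r1: "0 \<le> \<rho>1" "\<rho>1 < 1"
    "\<And>n. (\<Sum>x\<in>seqs n. \<Sum>y\<in>seqs n. ?Q n x y * ?bad n f1 (B_term W P U) x y) \<le> \<rho>1 ^ n"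
    by (rule chernoff_bound[of ?w \<delta> f1 "B_term W P U"]) (use w \<delta> in \<open>auto simp: B_term_def f1_def\<close>)
  obtain \<rho>2 where r2: "0 \<le> \<rho>2" "\<rho>2 < 1"
    "\<And>n. (\<Sum>x\<in>seqs n. \<Sum>y\<in>seqs n. ?Q n x y * ?bad n f2 (- out_entropy P U) x y) \<le> \<rho>2 ^ n"
    by (rule chernoff_bound[of ?w \<delta> f2 "- out_entropy P U"]) (use w \<delta> in \<open>auto simp: out_entropy_alt f2_def\<close>)
  obtain \<rho>3 where r3: "0 \<le> \<rho>3" "\<rho>3 < 1"
    "\<And>n. (\<Sum>x\<in>seqs n. \<Sum>y\<in>seqs n. ?Q n x y * ?bad n f3 (mut_info P U) x y) \<le> \<rho>3 ^ n"
    by (rule chernoff_bound[of ?w \<delta> f3 "mut_info P U"])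
       (use w \<delta> in \<open>auto simp: mut_info_eq[OF f] out_entropy_alt cond_entropy_def f3_def right_diff_distrib sum_subtractf\<close>)
  have "(\<lambda>n. \<rho>1 ^ n + \<rho>2 ^ n + \<rho>3 ^ n) \<longlonglongrightarrow> 0 + 0 + 0"
    using r1 r2 r3 by (intro tendsto_add LIMSEQ_realpow_zero)
  then have "\<forall>\<^sub>F n in sequentially. \<rho>1 ^ n + \<rho>2 ^ n + \<rho>3 ^ n < 1 / 2"
    by (rule order_tendstoD) simp
  then show ?thesis
  proof (rule eventually_mono)
    fix n assume n: "\<rho>1 ^ n + \<rho>2 ^ n + \<rho>3 ^ n < 1 / 2"
    \<comment> \<open>The union bound pointwise. If some letter pair has weight zero, the whole
      product is zero and the positivity clause of \<open>typical\<close> costs nothing.\<close>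
    have pt: "?Q n x y - ?Q n x y * ?bad n f1 (B_term W P U) x y - ?Q n x y * ?bad n f2 (- out_entropy P U) x y
        - ?Q n x y * ?bad n f3 (mut_info P U) x y \<le> ?Q n x y * (if typical W P U \<delta> n x y then 1 else 0)"
      for x y
    proof (cases "\<forall>i<n. 0 < P (x i) * U (x i) (y i)")
      case True
      then have "0 \<le> ?Q n x y" by (intro prod_nonneg) (auto simp: less_imp_le)
      then show ?thesis using True unfolding typical_def f1_def f2_def f3_def by auto
    next
      case False
      then obtain i where "i < n" "P (x i) * U (x i) (y i) = 0" using w(1) by (metis less_le)
      then have "?Q n x y = 0" by (intro prod_zero) auto
      moreover have "q - q * a - q * b - q * c \<le> q * d" if "q = 0" for q a b c d :: real
        using that by simp
      ultimately show ?thesis by blast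
    qed
    have "(\<Sum>x\<in>seqs n. \<Sum>y\<in>seqs n. ?Q n x y) = 1"
      using sum_seqs_prod2[where n = n and h = ?w] w(2) by simp
    then have "1 / 2 \<le> (\<Sum>x\<in>seqs n. \<Sum>y\<in>seqs n. ?Q n x y) -
       (\<Sum>x\<in>seqs n. \<Sum>y\<in>seqs n. ?Q n x y * ?bad n f1 (B_term W P U) x y) -
       (\<Sum>x\<in>seqs n. \<Sum>y\<in>seqs n. ?Q n x y * ?bad n f2 (- out_entropy P U) x y) -
       (\<Sum>x\<in>seqs n. \<Sum>y\<in>seqs n. ?Q n x y * ?bad n f3 (mut_info P U) x y)"
      using r1(3)[of n] r2(3)[of n] r3(3)[of n] n by linarith
    also have "\<dots> \<le> (\<Sum>x\<in>seqs n. \<Sum>y\<in>seqs n. ?Q n x y * (if typical W P U \<delta> n x y then 1 else 0))"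
      unfolding sum_subtractf[symmetric] by (intro sum_mono pt)
    finally show "1 / 2 \<le> \<dots>" .
  qed
qed

lemma typical_cong:
  assumes "\<And>i. i < n \<Longrightarrow> x i = x' i"
  shows "typical W P U \<delta> n x y = typical W P U \<delta> n x' y"
  unfolding typical_def using assms by simp

lemma prod_eq_exp_sum_ln:
  fixes n :: nat
  assumes "\<And>i. i < n \<Longrightarrow> 0 < g i"
  shows "(\<Prod>i<n. g i) = exp (\<Sum>i<n. ln (g i :: real))"
proof -
  have "(\<Prod>i<n. g i) = (\<Prod>i<n. exp (ln (g i)))" using assms by (intro prod.cong) auto
  then show ?thesis by (simp add: exp_sum)
qed

text \<open>The inequalities of \<open>typical\<close> after exponentiation. The last one is a
  change of measure from the joint law to the product of its marginals.\<close>

lemma typical_prods: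
  assumes f: "feasible W P U" and ty: "typical W P U \<delta> n x y"
  shows "exp (- real n * (B_term W P U + \<delta>)) \<le> seq_prob W n x y"
    and "0 < (\<Prod>i<n. out_distr P U (y i))"
    and "(\<Prod>i<n. out_distr P U (y i)) \<le> exp (- real n * (out_entropy P U - \<delta>))"
    and "(\<Prod>i<n. P (x i) * U (x i) (y i)) \<le>
      (\<Prod>i<n. P (x i)) * exp (n * (mut_info P U + \<delta>)) * (\<Prod>i<n. out_distr P U (y i))"
proof -
  have pu: "0 < P (x i) * U (x i) (y i)" if "i < n" for i using ty that by (auto simp: typical_def)
  have W: "0 < W (x i) (y i)" if "i < n" for i using feasibleD(5)[OF f pu[OF that]] .
  have q: "0 < out_distr P U (y i)" if "i < n" for i
    using pu[OF that] out_distr_ge[OF f, of "x i" "y i"] by linarith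
  have U: "0 < U (x i) (y i)" if "i < n" for i
    using pu[OF that] feasibleD(3)[OF f, of "x i" "y i"] by (auto simp: less_le)
  show "exp (- real n * (B_term W P U + \<delta>)) \<le> seq_prob W n x y"
    using ty W by (simp add: seq_prob_def prod_eq_exp_sum_ln typical_def sum_negf)
  show qpos: "0 < (\<Prod>i<n. out_distr P U (y i))" using q by (intro prod_pos) auto
  show "(\<Prod>i<n. out_distr P U (y i)) \<le> exp (- real n * (out_entropy P U - \<delta>))"
    using ty q by (simp add: prod_eq_exp_sum_ln typical_def algebra_simps)
  have "(\<Prod>i<n. U (x i) (y i)) = exp (\<Sum>i<n. ln (U (x i) (y i)) - ln (out_distr P U (y i))) * (\<Prod>i<n. out_distr P U (y i))"
    using U q by (simp add: prod_eq_exp_sum_ln exp_add[symmetric] sum_subtractf)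
  also have "\<dots> \<le> exp (n * (mut_info P U + \<delta>)) * (\<Prod>i<n. out_distr P U (y i))"
    using ty qpos by (intro mult_right_mono) (auto simp: typical_def)
  finally show "(\<Prod>i<n. P (x i) * U (x i) (y i)) \<le>
      (\<Prod>i<n. P (x i)) * exp (n * (mut_info P U + \<delta>)) * (\<Prod>i<n. out_distr P U (y i))"
    unfolding prod.distrib mult.assoc using feasibleD(1)[OF f] by (intro mult_left_mono prod_nonneg) auto
qed

section \<open>Lower bounds on the expected maximal count\<close>

lemma one_minus_exp_ge: "0 \<le> t \<Longrightarrow> min 1 t / 2 \<le> 1 - exp (- t :: real)"
proof -
  assume t: "0 \<le> t"
  have "exp (- t) \<le> 1 / (1 + t)"
    using exp_ge_add_one_self[of t] t by (simp add: exp_minus divide_simps add_nonneg_pos)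
  moreover have "min 1 t / 2 \<le> 1 - 1 / (1 + t)"
  proof (cases "1 \<le> t")
    case False
    then have "t * t \<le> 1 * t" using t by (intro mult_right_mono) auto
    then show ?thesis using False t by (simp add: min_def field_simps)
  qed (simp add: min_def field_simps)
  ultimately show ?thesis by linarith
qed

text \<open>Since the counts are integers, one of them reaching \<open>\<mu> / 4 > 0\<close> is at least 1 as well.\<close>

lemma max_count_ge:
  fixes M L :: nat
  assumes S: "S \<subseteq> {..<M}" and \<mu>: "0 < \<mu>"
  shows "max 1 (\<mu> / 4) * (1 - (\<Prod>m\<in>S. exp (\<mu> / 4 - real (cloud_count L Y m y)))) \<le> real (max_count M L Y y)"
proof (cases "\<exists>m\<in>S. \<mu> / 4 \<le> real (cloud_count L Y m y)")
  case True
  then obtain m where m: "m \<in> S" "\<mu> / 4 \<le> real (cloud_count L Y m y)" by blast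
  then have "max 1 (\<mu> / 4) \<le> real (cloud_count L Y m y)" using \<mu> by simp
  also have "\<dots> \<le> real (max_count M L Y y)" using S m(1) by (auto intro: cloud_count_le_max_count)
  finally have le: "max 1 (\<mu> / 4) \<le> real (max_count M L Y y)" .
  have "max 1 (\<mu> / 4) * (1 - (\<Prod>m\<in>S. exp (\<mu> / 4 - real (cloud_count L Y m y)))) \<le> max 1 (\<mu> / 4) * 1"
    by (intro mult_left_mono) (auto intro: prod_nonneg)
  then show ?thesis using le by linarith
next
  case False
  \<comment> \<open>If all counts stay below \<open>\<mu> / 4\<close>, every factor is at least 1
    and the left side is not positive: the product is a factorising upper bound for the indicator of
    this event.\<close>
  then have "1 \<le> (\<Prod>m\<in>S. exp (\<mu> / 4 - real (cloud_count L Y m y)))"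
    by (intro prod_ge_1) (auto simp: not_le less_imp_le)
  then have "max 1 (\<mu> / 4) * (1 - (\<Prod>m\<in>S. exp (\<mu> / 4 - real (cloud_count L Y m y)))) \<le> 0"
    by (intro mult_nonneg_nonpos) auto
  then show ?thesis by linarith
qed

text \<open>A lower-tail Chernoff bound. A selected count has mean at least \<open>\<mu>\<close>, so
  the expectation of \<open>exp (- N)\<close> is at most \<open>exp (- \<mu> / 2)\<close>; the
  threshold \<open>\<mu> / 4\<close> gives back half of this, and independence multiplies over
  messages.\<close>

lemma max_count_expect_ge:
  assumes W: "stoch_matrix W" and y: "y \<in> seqs n" and \<mu>: "0 < \<mu>"
    and S: "\<And>m. m < M \<Longrightarrow> T m \<Longrightarrow> \<mu> \<le> L * seq_prob W n (codeword C m) y"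
  shows "max 1 (\<mu> / 4) * (1 - (\<Prod>m<M. if T m then exp (- \<mu> / 4) else 1)) \<le>
    inst_expect W n M L C (\<lambda>Y. real (max_count M L Y y))"
proof -
  let ?s = "max 1 (\<mu> / 4)"
  \<comment> \<open>For a selected message with count \<open>N\<close>,
    \<open>?c m ^ N * ?d m\<close> is the factor \<open>exp (\<mu> / 4 - N)\<close> of
    \<open>max_count_ge\<close>; for the others it is 1.\<close>
  let ?c = "\<lambda>m. if T m then exp (- 1 :: real) else 1"
  let ?d = "\<lambda>m. if T m then exp (\<mu> / 4) else (1::real)"
  have "inst_expect W n M L C (\<lambda>Y. \<Prod>m<M. ?c m ^ cloud_count L Y m y) * (\<Prod>m<M. ?d m)
     \<le> (\<Prod>m<M. if T m then exp (- \<mu> / 4) else 1)"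
    unfolding inst_expect_prod_power[OF W y] prod.distrib[symmetric]
  proof (intro prod_mono conjI)
    fix m assume "m \<in> {..<M}"
    let ?p = "seq_prob W n (codeword C m) y"
    have p: "0 \<le> ?p" "?p \<le> 1" using seq_prob_nonneg[OF W] seq_prob_le_1[OF W y] by auto
    \<comment> \<open>This bound turns the mean \<open>\<mu>\<close> into the exponent
      \<open>\<mu> / 2\<close>.\<close>
    have e: "exp (- 1 :: real) \<le> 1 / 2" using exp_ge_add_one_self[of 1] by (simp add: exp_minus divide_simps)
    have nn: "0 \<le> 1 + ?p * (exp (- 1) - 1)"
    proof -
      have "?p * (1 - exp (- 1)) \<le> 1 * 1" using p by (intro mult_mono) auto
      then show ?thesis by (simp add: algebra_simps)
    qed
    then show "0 \<le> (1 + ?p * (?c m - 1)) ^ L * ?d m" by auto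
    show "(1 + ?p * (?c m - 1)) ^ L * ?d m \<le> (if T m then exp (- \<mu> / 4) else 1)"
    proof (cases "T m")
      case True
      have "1 + ?p * (exp (- 1) - 1) \<le> 1 + ?p * (- 1 / 2)"
        using p e by (intro add_left_mono mult_left_mono) auto
      also have "\<dots> \<le> exp (- ?p / 2)" using exp_ge_add_one_self[of "- ?p / 2"] by simp
      finally have "(1 + ?p * (exp (- 1) - 1)) ^ L \<le> exp (- ?p / 2) ^ L" using nn by (intro power_mono)
      also have "\<dots> = exp (- (L * ?p) / 2)" by (simp add: exp_of_nat_mult[symmetric])
      also have "\<dots> \<le> exp (- \<mu> / 2)" using S[of m] True \<open>m \<in> _\<close> by simp
      finally have "(1 + ?p * (exp (- 1) - 1)) ^ L * exp (\<mu> / 4) \<le> exp (- \<mu> / 2) * exp (\<mu> / 4)"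
        by (intro mult_right_mono) auto
      then show ?thesis using True by (simp add: exp_add[symmetric])
    qed simp
  qed
  then have "?s * (1 - (\<Prod>m<M. if T m then exp (- \<mu> / 4) else 1)) \<le>
     ?s * (1 - (\<Prod>m<M. ?d m) * inst_expect W n M L C (\<lambda>Y. \<Prod>m<M. ?c m ^ cloud_count L Y m y))"
    by (intro mult_left_mono) (auto simp: mult.commute)
  also have "\<dots> = inst_expect W n M L C
      (\<lambda>Y. ?s * (1 + (- (\<Prod>m<M. ?d m)) * (\<Prod>m<M. ?c m ^ cloud_count L Y m y)))"
    unfolding inst_expect_cmult inst_expect_add inst_expect_const[OF W] by simp
  also have "\<dots> \<le> inst_expect W n M L C (\<lambda>Y. real (max_count M L Y y))"
  proof (rule inst_expect_mono[OF W])
    fix Y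
    have "(\<Prod>m<M. ?d m) * (\<Prod>m<M. ?c m ^ cloud_count L Y m y) =
      (\<Prod>m<M. if T m then exp (\<mu> / 4 - real (cloud_count L Y m y)) else 1)"
      unfolding prod.distrib[symmetric]
      by (intro prod.cong refl) (simp add: exp_of_nat_mult[symmetric] exp_add[symmetric])
    also have "\<dots> = (\<Prod>m\<in>{m\<in>{..<M}. T m}. exp (\<mu> / 4 - real (cloud_count L Y m y)))"
      by (rule prod.inter_filter[symmetric]) simp
    finally show "?s * (1 + (- (\<Prod>m<M. ?d m)) * (\<Prod>m<M. ?c m ^ cloud_count L Y m y)) \<le> real (max_count M L Y y)"
      using max_count_ge[of "{m\<in>{..<M}. T m}" M \<mu> L Y y] \<mu> by auto
  qed
  finally show ?thesis .
qed

section \<open>Averaging over i.i.d. codebooks\<close>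

definition book_prob :: "('x \<Rightarrow> real) \<Rightarrow> nat \<Rightarrow> nat \<Rightarrow> (nat \<times> nat \<Rightarrow> 'x) \<Rightarrow> real" where
  "book_prob P M n C = (\<Prod>mi\<in>{..<M} \<times> {..<n}. P (C mi))"

lemma book_prob_eq: "book_prob P M n C = (\<Prod>m<M. \<Prod>i<n. P (codeword C m i))"
  unfolding book_prob_def prod.cartesian_product by (simp add: codeword_def case_prod_unfold)

lemma book_prob_nonneg: "prob_distr P \<Longrightarrow> 0 \<le> book_prob P M n C"
  unfolding book_prob_def by (auto intro: prod_nonneg simp: prob_distr_def)

text \<open>The codewords are independent and identically distributed, so the average of a product
  over messages is a power.\<close>

lemma book_expect_prod:
  fixes P :: "'x::finite \<Rightarrow> real"
  assumes "\<And>x x'. (\<And>i. i < n \<Longrightarrow> x i = x' i) \<Longrightarrow> \<phi> x = \<phi> x'"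
  shows "(\<Sum>C\<in>codebooks M n. book_prob P M n C * (\<Prod>m<M. \<phi> (codeword C m))) =
    (\<Sum>x\<in>seqs n. (\<Prod>i<n. P (x i)) * \<phi> x) ^ M"
proof -
  have "(\<Sum>C\<in>codebooks M n. book_prob P M n C * (\<Prod>m<M. \<phi> (codeword C m))) =
    (\<Sum>C\<in>codebooks M n. \<Prod>m<M. (\<Prod>i<n. P (codeword C m i)) * \<phi> (codeword C m))"
    unfolding book_prob_eq prod.distrib ..
  also have "\<dots> = (\<Prod>m<M. \<Sum>x\<in>seqs n. (\<Prod>i<n. P (x i)) * \<phi> x)"
  proof (rule sum_codewords_prod)
    fix m :: nat and x x' :: "nat \<Rightarrow> 'x" assume "\<And>i. i < n \<Longrightarrow> x i = x' i"
    then show "(\<Prod>i<n. P (x i)) * \<phi> x = (\<Prod>i<n. P (x' i)) * \<phi> x'"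
      using assms[of x x'] by simp
  qed
  finally show ?thesis by simp
qed

lemma sum_iid: "prob_distr P \<Longrightarrow> (\<Sum>x\<in>seqs n. \<Prod>i<n. P (x i)) = 1"
  using sum_seqs_prod[of "\<lambda>_. P" n] by (simp add: prob_distr_def)

lemma sum_book_prob: "prob_distr P \<Longrightarrow> (\<Sum>C\<in>codebooks M n. book_prob P M n C) = 1"
  using book_expect_prod[where \<phi> = "\<lambda>_. 1" and P = P and n = n and M = M] by (simp add: sum_iid)

lemma avg_correct_eq:
  assumes "prob_distr P"
  shows "1 - avg_err_prob W R K P n =
    (\<Sum>C\<in>codebooks (num_msgs R n) n. book_prob P (num_msgs R n) n C * (1 - err_prob W R K n C))"
  by (simp add: avg_err_prob_def book_prob_def[symmetric] right_diff_distrib sum_subtractf sum_book_prob[OF assms])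

text \<open>If every codebook were strictly worse than the average, averaging would give a
  contradiction; some codebook has positive weight, which keeps the inequality strict.\<close>

lemma exists_codebook:
  fixes P :: "'x::finite \<Rightarrow> real"
  assumes P: "prob_distr P"
  obtains C where "C \<in> codebooks (num_msgs R n) n" "1 - avg_err_prob W R K P n \<le> 1 - err_prob W R K n C"
proof (rule ccontr)
  note witness = that
  let ?M = "num_msgs R n"
  let ?w = "book_prob P ?M n"
  assume neg: "\<not> thesis"
  have less: "1 - err_prob W R K n C < 1 - avg_err_prob W R K P n" if C: "C \<in> codebooks ?M n" for C
    using neg witness[OF C] not_le by blast
  obtain C0 where C0: "C0 \<in> codebooks ?M n" "?w C0 \<noteq> 0"
    using sum_book_prob[OF P, of ?M n] by (metis sum.neutral zero_neq_one)
  have "(\<Sum>C\<in>codebooks ?M n. ?w C * (1 - err_prob W R K n C)) <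
      (\<Sum>C\<in>codebooks ?M n. ?w C * (1 - avg_err_prob W R K P n))"
  proof (rule sum_strict_mono_ex1)
    show "\<exists>C\<in>codebooks ?M n. ?w C * (1 - err_prob W R K n C) < ?w C * (1 - avg_err_prob W R K P n)"
      using C0 less[OF C0(1)] book_prob_nonneg[OF P, of ?M n C0]
      by (intro bexI[OF _ C0(1)] mult_strict_left_mono) (auto simp: less_le)
    show "\<forall>C\<in>codebooks ?M n. ?w C * (1 - err_prob W R K n C) \<le> ?w C * (1 - avg_err_prob W R K P n)"
      by (intro ballI mult_left_mono book_prob_nonneg P less_imp_le[OF less])
  qed simp
  also have "\<dots> = 1 - avg_err_prob W R K P n"
    by (simp only: sum_distrib_right[symmetric] sum_book_prob[OF P] mult_1)
  finally show False by (simp add: avg_correct_eq[OF P])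
qed

text \<open>For \<open>M\<close> independent events of probability \<open>q\<close>, the union bound
  on the probability that one of them occurs is tight up to a factor 2.\<close>

lemma one_minus_power_ge:
  assumes "0 \<le> q" "q \<le> (1::real)"
  shows "min 1 (M * q) / 2 \<le> 1 - (1 - q) ^ M"
proof -
  have "(1 - q) ^ M \<le> exp (- q) ^ M"
    using assms exp_ge_add_one_self[of "- q"] by (intro power_mono) auto
  also have "\<dots> = exp (- (M * q))" by (simp add: exp_of_nat_mult[symmetric])
  finally show ?thesis using one_minus_exp_ge[of "M * q"] assms by simp
qed

text \<open>Pulls a factor out of the minimum; this later makes the bound for each received vector
  linear in \<open>\<kappa> y\<close>.\<close>

lemma min_mult_ge: "0 \<le> k \<Longrightarrow> k \<le> 1 \<Longrightarrow> 0 \<le> t \<Longrightarrow> k * min 1 t \<le> min 1 (k * t :: real)"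
  using mult_left_mono[of "min 1 t" t k] mult_left_mono[of "min 1 t" 1 k] by auto

text \<open>For fixed \<open>y\<close>, random codewords are independently typical with
  \<open>y\<close>, and \<open>max_count_expect_ge\<close> applies to the typical ones. The
  resulting bounds, proportional to \<open>\<kappa> y\<close>, are summed over \<open>y\<close>; the
  mass of typical pairs turns this sum into the exponential of the output entropy.\<close>

lemma avg_correct_ge:
  fixes W :: "'x::finite \<Rightarrow> 'y::finite \<Rightarrow> real"
  assumes W: "stoch_matrix W" and R: "0 < R" and K: "0 < K" and f: "feasible W P U"
    and mass: "1 / 2 \<le> (\<Sum>x\<in>seqs n. \<Sum>y\<in>seqs n.
      (\<Prod>i<n. P (x i) * U (x i) (y i)) * (if typical W P U \<delta> n x y then 1 else 0))"
    and M: "M = num_msgs R n" and L: "L = num_msgs K n"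
    and \<mu>: "\<mu> = L * exp (- real n * (B_term W P U + \<delta>))"
  shows "max 1 (\<mu> / 4) / 2 * min 1 (M * exp (- real n * (mut_info P U + \<delta>)) * (min 1 (\<mu> / 4) / 2)) *
      (exp (real n * (out_entropy P U - \<delta>)) / 2) / (real M * real L) \<le> 1 - avg_err_prob W R K P n"
proof -
  let ?T = "\<lambda>x y. typical W P U \<delta> n x y"
  let ?Pn = "\<lambda>x. \<Prod>i<n. P (x i)"
  let ?Q = "\<lambda>x y. \<Prod>i<n. P (x i) * U (x i) (y i)"
  let ?q = "\<lambda>y. \<Prod>i<n. out_distr P U (y i)"
  let ?s = "max 1 (\<mu> / 4)"
  let ?r = "exp (- \<mu> / 4)"
  let ?i = "exp (- real n * (mut_info P U + \<delta>))"
  define h where "h = exp (real n * (out_entropy P U - \<delta>))"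
  define t where "t = M * ?i * (min 1 (\<mu> / 4) / 2)"
  \<comment> \<open>The conditional probability under \<open>PU\<close>, given the output
    \<open>y\<close>, that the input is typical with \<open>y\<close>.\<close>
  define \<kappa> where "\<kappa> y = (\<Sum>x\<in>seqs n. if ?T x y then ?Q x y / ?q y else 0)" for y
  have P: "prob_distr P" using f by (simp add: feasible_def)
  have Pn: "0 \<le> ?Pn x" for x using P by (auto intro: prod_nonneg simp: prob_distr_def)
  have M1: "1 \<le> M" "1 \<le> L" using num_msgs_bounds(1) R K M L by auto
  then have \<mu>0: "0 < \<mu>" by (simp add: \<mu>)
  have t0: "0 \<le> t" using \<mu>0 by (simp add: t_def)
  have Q: "0 \<le> ?Q x y" for x y using feasibleD[OF f] by (auto intro!: prod_nonneg)
  have q0: "0 \<le> ?q y" for y using out_distr_nonneg[OF f] by (auto intro!: prod_nonneg)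
  have \<kappa>0: "0 \<le> \<kappa> y" for y unfolding \<kappa>_def using Q q0 by (auto intro!: sum_nonneg)
  have \<kappa>1: "\<kappa> y \<le> 1" for y
  proof -
    have "\<kappa> y \<le> (\<Sum>x\<in>seqs n. ?Q x y / ?q y)"
      unfolding \<kappa>_def using Q q0 by (intro sum_mono) auto
    also have "\<dots> = ?q y / ?q y"
      using sum_seqs_prod[of "\<lambda>i a. P a * U a (y i)" n]
      by (simp add: sum_divide_distrib[symmetric] out_distr_def)
    \<comment> \<open>The quotient is 1, or 0 by the convention for division when
      \<open>?q y\<close> vanishes.\<close>
    also have "\<dots> \<le> 1" by (simp add: divide_self_if)
    finally show ?thesis .
  qed
  \<comment> \<open>The coefficient of \<open>\<kappa> y\<close> does not depend on \<open>y\<close>, so that only the total mass of typical pairs enters.\<close>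
  have per_y: "?s / 2 * min 1 t * \<kappa> y \<le> (\<Sum>C\<in>codebooks M n. book_prob P M n C *
        inst_expect W n M L C (\<lambda>Y. real (max_count M L Y y)))" if y: "y \<in> seqs n" for y
  proof -
    define a where "a = (\<Sum>x\<in>seqs n. if ?T x y then ?Pn x else 0)"
    have a0: "0 \<le> a" unfolding a_def using Pn by (auto intro!: sum_nonneg)
    have a1: "a \<le> 1" unfolding a_def sum_iid[OF P, of n, symmetric] using Pn by (intro sum_mono) auto
    have r1: "?r < 1" using \<mu>0 by simp
    have q1: "0 \<le> a * (1 - ?r)" "a * (1 - ?r) \<le> 1"
      using a0 a1 r1 by (auto intro!: mult_nonneg_nonneg mult_le_one)
    \<comment> \<open>Change of measure: independent of \<open>y\<close>, a codeword is typical with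
      it at a cost of at most \<open>exp (n * (mut_info P U + \<delta>))\<close>.\<close>
    have "?i * \<kappa> y \<le> a"
      unfolding \<kappa>_def a_def sum_distrib_left
    proof (rule sum_mono)
      fix x
      show "?i * (if ?T x y then ?Q x y / ?q y else 0) \<le> (if ?T x y then ?Pn x else 0)"
      proof (cases "?T x y")
        case True
        have "?Q x y / ?q y \<le> ?Pn x * exp (n * (mut_info P U + \<delta>))"
          using typical_prods(2,4)[OF f True] by (simp add: divide_le_eq mult_ac)
        then have "?i * (?Q x y / ?q y) \<le> ?i * (?Pn x * exp (n * (mut_info P U + \<delta>)))"
          by (intro mult_left_mono) auto
        also have "\<dots> = ?Pn x * (?i * exp (n * (mut_info P U + \<delta>)))" by (simp only: mult_ac)
        also have "?i * exp (n * (mut_info P U + \<delta>)) = 1"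
          unfolding exp_add[symmetric] by simp
        finally show ?thesis using True by simp
      qed simp
    qed
    moreover have "min 1 (\<mu> / 4) / 2 \<le> 1 - ?r" using one_minus_exp_ge[of "\<mu> / 4"] \<mu>0 by simp
    ultimately have "M * ((?i * \<kappa> y) * (min 1 (\<mu> / 4) / 2)) \<le> M * (a * (1 - ?r))"
      using \<kappa>0 a0 \<mu>0 by (intro mult_left_mono mult_mono) auto
    then have "\<kappa> y * t \<le> M * (a * (1 - ?r))" by (simp add: t_def mult_ac)
    then have "\<kappa> y * min 1 t \<le> min 1 (M * (a * (1 - ?r)))"
      using min_mult_ge[OF \<kappa>0[of y] \<kappa>1[of y] t0] by linarith
    also have "\<dots> / 2 \<le> 1 - (1 - a * (1 - ?r)) ^ M" by (rule one_minus_power_ge[OF q1])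
    finally have "?s * (\<kappa> y * min 1 t / 2) \<le> ?s * (1 - (1 - a * (1 - ?r)) ^ M)"
      by (intro mult_left_mono) (auto simp: divide_right_mono)
    \<comment> \<open>A random codeword contributes the factor \<open>?r\<close> with probability
      \<open>a\<close> and the factor 1 otherwise.\<close>
    also have "1 - a * (1 - ?r) = (\<Sum>x\<in>seqs n. ?Pn x * (if ?T x y then ?r else 1))"
    proof -
      have "(\<Sum>x\<in>seqs n. ?Pn x * (if ?T x y then ?r else 1)) =
         (\<Sum>x\<in>seqs n. ?Pn x - (if ?T x y then ?Pn x else 0) * (1 - ?r))"
        by (intro sum.cong) (auto simp: algebra_simps)
      then show ?thesis by (simp add: sum_subtractf sum_iid[OF P] a_def sum_distrib_right)
    qed
    also have "(\<Sum>x\<in>seqs n. ?Pn x * (if ?T x y then ?r else 1)) ^ M =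
        (\<Sum>C\<in>codebooks M n. book_prob P M n C * (\<Prod>m<M. if ?T (codeword C m) y then ?r else 1))"
    proof (rule book_expect_prod[symmetric])
      fix x x' :: "nat \<Rightarrow> 'x" assume "\<And>i. i < n \<Longrightarrow> x i = x' i"
      then have "?T x y = ?T x' y" by (rule typical_cong)
      then show "(if ?T x y then ?r else 1) = (if ?T x' y then ?r else 1)" by simp
    qed
    also have "?s * (1 - \<dots>) =
        (\<Sum>C\<in>codebooks M n. book_prob P M n C * (?s * (1 - (\<Prod>m<M. if ?T (codeword C m) y then ?r else 1))))"
    proof -
      have "(\<Sum>C\<in>codebooks M n. book_prob P M n C * (?s * (1 - g C))) =
         ?s * (1 - (\<Sum>C\<in>codebooks M n. book_prob P M n C * g C))" for g
      proof -
        have "(\<Sum>C\<in>codebooks M n. book_prob P M n C * (?s * (1 - g C))) =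
          ?s * (\<Sum>C\<in>codebooks M n. book_prob P M n C - book_prob P M n C * g C)"
          unfolding sum_distrib_left by (intro sum.cong) (simp_all add: algebra_simps)
        then show ?thesis by (simp add: sum_subtractf sum_book_prob[OF P])
      qed
      then show ?thesis by simp
    qed
    also have "\<dots> \<le> (\<Sum>C\<in>codebooks M n. book_prob P M n C *
        inst_expect W n M L C (\<lambda>Y. real (max_count M L Y y)))"
      using typical_prods(1)[OF f]
      by (intro sum_mono mult_left_mono book_prob_nonneg P max_count_expect_ge[OF W y \<mu>0])
         (auto simp: \<mu> intro!: mult_left_mono)
    finally show ?thesis by (simp add: mult_ac)
  qed
  \<comment> \<open>In a typical pair the output probability is at most \<open>1 / h\<close>, so
    dividing by it gains at least \<open>h\<close> on a typical mass of at least one half.\<close>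
  have sum_\<kappa>: "h / 2 \<le> (\<Sum>y\<in>seqs n. \<kappa> y)"
  proof -
    have pt: "h * (?Q x y * (if ?T x y then 1 else 0)) \<le> (if ?T x y then ?Q x y / ?q y else 0)" for x y
    proof (cases "?T x y")
      case True
      have "h * ?q y \<le> h * exp (- real n * (out_entropy P U - \<delta>))"
        using typical_prods(3)[OF f True] by (intro mult_left_mono) (auto simp: h_def)
      also have "\<dots> = 1" by (simp add: h_def exp_add[symmetric])
      finally have "?Q x y * (h * ?q y) \<le> ?Q x y" using mult_left_mono[OF _ Q, of "h * ?q y" 1] by simp
      then show ?thesis using True typical_prods(2)[OF f True] by (simp add: le_divide_eq mult_ac)
    qed simp
    have "h * (1 / 2) \<le> h * (\<Sum>x\<in>seqs n. \<Sum>y\<in>seqs n. ?Q x y * (if ?T x y then 1 else 0))"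
      using mass by (intro mult_left_mono) (auto simp: h_def)
    also have "\<dots> \<le> (\<Sum>x\<in>seqs n. \<Sum>y\<in>seqs n. if ?T x y then ?Q x y / ?q y else 0)"
      unfolding sum_distrib_left by (intro sum_mono pt)
    also have "\<dots> = (\<Sum>y\<in>seqs n. \<kappa> y)" unfolding \<kappa>_def by (rule sum.swap)
    finally show ?thesis by simp
  qed
  have "?s / 2 * min 1 t * (h / 2) \<le> ?s / 2 * min 1 t * (\<Sum>y\<in>seqs n. \<kappa> y)"
    using t0 by (intro mult_left_mono sum_\<kappa>) auto
  also have "\<dots> \<le> (\<Sum>y\<in>seqs n. \<Sum>C\<in>codebooks M n. book_prob P M n C *
        inst_expect W n M L C (\<lambda>Y. real (max_count M L Y y)))"
    unfolding sum_distrib_left by (intro sum_mono per_y)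
  also have "\<dots> = (\<Sum>C\<in>codebooks M n. \<Sum>y\<in>seqs n. book_prob P M n C *
        inst_expect W n M L C (\<lambda>Y. real (max_count M L Y y)))"
    by (rule sum.swap)
  finally have "?s / 2 * min 1 t * (h / 2) / (real M * real L) \<le> (\<Sum>C\<in>codebooks M n. \<Sum>y\<in>seqs n. book_prob P M n C *
        inst_expect W n M L C (\<lambda>Y. real (max_count M L Y y))) / (real M * real L)"
    by (intro divide_right_mono) auto
  also have "\<dots> = 1 - avg_err_prob W R K P n"
    unfolding avg_correct_eq[OF P] correct_prob_eq[OF W R K] M[symmetric] L[symmetric]
    by (simp add: sum_divide_distrib sum_distrib_left)
  finally show ?thesis by (simp add: t_def h_def)
qed

lemma min_1_exp: "min 1 (exp a) = exp (min 0 a :: real)"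
  by (simp add: min_def)

text \<open>Turns the previous bound into a pure exponential: maxima and minima with 1 become
  positive and negative parts of exponents, at the cost of constants.\<close>

lemma avg_correct_ge_exp:
  fixes W :: "'x::finite \<Rightarrow> 'y::finite \<Rightarrow> real"
  assumes W: "stoch_matrix W" and R: "0 < R" and K: "0 < K" and f: "feasible W P U" and \<delta>: "0 < \<delta>"
    and mass: "1 / 2 \<le> (\<Sum>x\<in>seqs n. \<Sum>y\<in>seqs n.
      (\<Prod>i<n. P (x i) * U (x i) (y i)) * (if typical W P U \<delta> n x y then 1 else 0))"
  shows "exp (- real n * (exponent W R K P U + 4 * \<delta>)) / 1024 \<le> 1 - avg_err_prob W R K P n"
proof -
  define M L where "M = num_msgs R n" and "L = num_msgs K n"
  define B I Ho where "B = B_term W P U" and "I = mut_info P U" and "Ho = out_entropy P U"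
  define \<mu> where "\<mu> = L * exp (- real n * (B + \<delta>))"
  define \<nu> where "\<nu> = exp (n * (K - B - \<delta>))"
  define z where "z = exp (n * (R - I - \<delta>)) * min 1 \<nu>"
  define t where "t = M * exp (- real n * (I + \<delta>)) * (min 1 (\<mu> / 4) / 2)"
  define h where "h = exp (n * (Ho - \<delta>))"
  have M1: "1 \<le> M" "real M \<le> exp (n * R)" "exp (n * R) / 2 \<le> real M"
    using num_msgs_bounds[OF R, of n] by (auto simp: M_def)
  have L1: "1 \<le> L" "real L \<le> exp (n * K)" "exp (n * K) / 2 \<le> real L"
    using num_msgs_bounds[OF K, of n] by (auto simp: L_def)
  have \<nu>\<mu>: "\<nu> / 2 \<le> \<mu>"
  proof -
    have "\<nu> / 2 = (exp (n * K) / 2) * exp (- real n * (B + \<delta>))"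
      by (simp add: \<nu>_def exp_add[symmetric] algebra_simps)
    also have "\<dots> \<le> \<mu>" unfolding \<mu>_def using L1 by (intro mult_right_mono) auto
    finally show ?thesis .
  qed
  have z0: "0 < z" by (simp add: z_def \<nu>_def)
  \<comment> \<open>The 8 combines the threshold \<open>\<mu> / 4\<close> with the factor 2 of
    \<open>\<nu>\<mu>\<close>, which comes from the floor in \<open>L\<close>.\<close>
  have mx: "max 1 \<nu> / 8 \<le> max 1 (\<mu> / 4)" and mn: "min 1 \<nu> / 8 \<le> min 1 (\<mu> / 4)"
    using \<nu>\<mu> by (auto simp: \<nu>_def)
  \<comment> \<open>Here 32 is 2 from the floor in \<open>M\<close>, times 8 from \<open>mn\<close>,
    times the 2 in the definition of \<open>t\<close>.\<close>
  have "z / 32 = (exp (n * R) / 2) * exp (- real n * (I + \<delta>)) * (min 1 \<nu> / 8 / 2)"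
    by (simp add: z_def exp_add[symmetric] algebra_simps)
  also have "\<dots> \<le> t"
    unfolding t_def using M1 mn by (intro mult_mono) (auto simp: \<nu>_def)
  finally have "z / 32 \<le> t" .
  then have tz: "min 1 z / 32 \<le> min 1 t" by auto
  have min0: "min 1 z = exp (n * min 0 (R - I - \<delta> - pos_part (B + \<delta> - K)))"
  proof -
    have "min 0 (n * (K - B - \<delta>)) = n * min 0 (K - B - \<delta>)"
      by (auto simp: min_def zero_le_mult_iff)
    also have "min 0 (K - B - \<delta>) = - pos_part (B + \<delta> - K)" by (simp add: pos_part_def)
    finally have "min 0 (n * (K - B - \<delta>)) = n * - pos_part (B + \<delta> - K)" .
    then have "z = exp (n * (R - I - \<delta> - pos_part (B + \<delta> - K)))"
      unfolding z_def \<nu>_def min_1_exp by (simp add: exp_add[symmetric] algebra_simps)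
    then show ?thesis
      by (simp add: min_def zero_le_mult_iff)
  qed
  have max0: "max 1 \<nu> = exp (n * pos_part (K - B - \<delta>))"
    by (auto simp: \<nu>_def pos_part_def max_def mult_le_0_iff zero_le_mult_iff)
  \<comment> \<open>For \<open>\<delta> = 0\<close> both sides agree, since a number is the
    difference of its positive and negative parts. The first positive part and the entropy lose at
    most one \<open>\<delta>\<close> each and the minimum at most two.\<close>
  have "- (exponent W R K P U + 4 * \<delta>) \<le>
      pos_part (K - B - \<delta>) + min 0 (R - I - \<delta> - pos_part (B + \<delta> - K)) + (Ho - \<delta>) - R - K"
    using \<delta> unfolding exponent_def cond_div_eq[OF f] B_def I_def Ho_def mut_info_eq[OF f] pos_part_def
    by linarith
  then have "real n * - (exponent W R K P U + 4 * \<delta>) \<le>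
      n * (pos_part (K - B - \<delta>) + min 0 (R - I - \<delta> - pos_part (B + \<delta> - K)) + (Ho - \<delta>) - R - K)"
    by (intro mult_left_mono) auto
  then have "exp (- real n * (exponent W R K P U + 4 * \<delta>)) \<le>
      exp (real n * (pos_part (K - B - \<delta>) + min 0 (R - I - \<delta> - pos_part (B + \<delta> - K)) + (Ho - \<delta>) - R - K))"
    by (simp only: exp_le_cancel_iff mult_minus_left mult_minus_right)
  also have "\<dots> = max 1 \<nu> * min 1 z * h / (exp (n * R) * exp (n * K))"
    unfolding min0 max0 h_def exp_add[symmetric] exp_diff[symmetric] by (simp add: algebra_simps)
  \<comment> \<open>The constants multiply: 1024 is 16 times 32 times 2.\<close>
  finally have "exp (- real n * (exponent W R K P U + 4 * \<delta>)) / 1024 \<le>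
      (max 1 \<nu> / 8 / 2) * (min 1 z / 32) * (h / 2) / (exp (n * R) * exp (n * K))"
    by simp
  also have "\<dots> \<le> (max 1 (\<mu> / 4) / 2) * min 1 t * (h / 2) / (real M * real L)"
  proof (rule frac_le)
    have t0: "0 \<le> min 1 t" using \<open>z / 32 \<le> t\<close> z0 by simp
    show "(max 1 \<nu> / 8 / 2) * (min 1 z / 32) * (h / 2) \<le> (max 1 (\<mu> / 4) / 2) * min 1 t * (h / 2)"
      using z0 t0 by (intro mult_right_mono mult_mono divide_right_mono mx tz) (auto simp: h_def)
    show "0 \<le> (max 1 (\<mu> / 4) / 2) * min 1 t * (h / 2)"
      using t0 by (intro mult_nonneg_nonneg) (auto simp: h_def)
    show "real M * real L \<le> exp (n * R) * exp (n * K)" using M1 L1 by (intro mult_mono) auto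
  qed (use M1 L1 in simp)
  also have "\<dots> \<le> 1 - avg_err_prob W R K P n"
    unfolding h_def t_def I_def Ho_def
    by (rule avg_correct_ge[OF W R K f mass M_def L_def]) (simp add: \<mu>_def B_def)
  finally show ?thesis .
qed

text \<open>The counts of message 0 alone add up to \<open>L\<close>, so the maxima do at least as
  well. Positivity makes the logarithm in the converse genuine.\<close>

lemma correct_prob_pos:
  fixes W :: "'x::finite \<Rightarrow> 'y::finite \<Rightarrow> real"
  assumes W: "stoch_matrix W" and R: "0 < R" and K: "0 < K"
  shows "0 < 1 - err_prob W R K n C"
proof -
  define M L where "M = num_msgs R n" and "L = num_msgs K n"
  have M1: "1 \<le> M" "1 \<le> L" using num_msgs_bounds(1) R K by (auto simp: M_def L_def)
  have "real L = inst_expect W n M L C (\<lambda>Y. real L)" by (simp add: inst_expect_const[OF W])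
  also have "\<dots> \<le> inst_expect W n M L C (\<lambda>Y. \<Sum>y\<in>seqs n. real (max_count M L Y y))"
  proof (rule inst_expect_mono[OF W])
    fix Y :: "nat \<times> nat \<Rightarrow> nat \<Rightarrow> 'y" assume "Y \<in> instances n M L"
    then have "real L = (\<Sum>y\<in>seqs n. real (cloud_count L Y 0 y))"
      using sum_over_cloud[of L Y 0 n "\<lambda>_. 1"] M1 by (simp add: instances_seqs)
    also have "\<dots> \<le> (\<Sum>y\<in>seqs n. real (max_count M L Y y))"
      using M1 by (intro sum_mono) (simp add: cloud_count_le_max_count)
    finally show "real L \<le> (\<Sum>y\<in>seqs n. real (max_count M L Y y))" .
  qed
  finally have "real L \<le> (\<Sum>y\<in>seqs n. inst_expect W n M L C (\<lambda>Y. real (max_count M L Y y)))"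
    by (simp add: inst_expect_sum)
  then show ?thesis
    unfolding correct_prob_eq[OF W R K] M_def[symmetric] L_def[symmetric] using M1 by (intro divide_pos_pos) auto
qed

section \<open>Passage to the limit\<close>

lemma neg_ln_le:
  assumes "0 < n" "exp (- real n * c) \<le> p"
  shows "- (1 / real n) * ln p \<le> c"
proof -
  have "0 < p" using assms(2) exp_gt_zero less_le_trans by blast
  then have "- real n * c \<le> ln p" using assms(2) by (simp add: ln_ge_iff)
  then show ?thesis using assms(1) by (simp add: field_simps)
qed

theorem theorem4:
  fixes W :: "'x::finite \<Rightarrow> 'y::finite \<Rightarrow> real" and R K :: real
  assumes "stoch_matrix W" and "R > 0" and "K > 0"
  shows "((\<lambda>n. Inf {- (1 / real n) * ln (1 - err_prob W R K n C) | C. C \<in> codebooks (num_msgs R n) n})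
            \<longlonglongrightarrow> E_c W R K) \<and>
         (\<exists>P. prob_distr P \<and>
           limsup (\<lambda>n. ereal (- (1 / real n) * ln (1 - avg_err_prob W R K P n)))
             \<le> ereal (E_c W R K))"
proof -
  note W = assms(1) and R = assms(2) and K = assms(3)
  let ?E = "E_c W R K"
  let ?S = "\<lambda>n. {- (1 / real n) * ln (1 - err_prob W R K n C) | C. C \<in> codebooks (num_msgs R n) n}"
  obtain P U where f: "feasible W P U" and E: "?E = exponent W R K P U"
    using exponent_minimiser[OF W, of R K] by metis
  have P: "prob_distr P" using f by (simp add: feasible_def)
  \<comment> \<open>Typicality with \<open>\<epsilon> / 8\<close> costs four times that, half of
    \<open>\<epsilon>\<close>; the other half eventually absorbs the constant 1024.\<close>
  have avg: "\<forall>\<^sub>F n in sequentially. 0 < n \<and> exp (- real n * (?E + \<epsilon>)) \<le> 1 - avg_err_prob W R K P n"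
    if \<epsilon>: "0 < \<epsilon>" for \<epsilon>
  proof -
    have "filterlim (\<lambda>n. exp (real n * (\<epsilon> / 2))) at_top sequentially" using \<epsilon> by real_asymp
    then have "\<forall>\<^sub>F n in sequentially. 1024 \<le> exp (real n * (\<epsilon> / 2))"
      by (simp add: filterlim_at_top)
    moreover have "\<forall>\<^sub>F n in sequentially. 1 / 2 \<le> (\<Sum>x\<in>seqs n. \<Sum>y\<in>seqs n.
      (\<Prod>i<n. P (x i) * U (x i) (y i)) * (if typical W P U (\<epsilon> / 8) n x y then 1 else 0))"
      by (rule typical_mass[OF f]) (use \<epsilon> in simp)
    ultimately show ?thesis using eventually_gt_at_top[of 0]
    proof eventually_elim
      case (elim n)
      have "exp (- real n * (?E + \<epsilon>)) = exp (- real n * (?E + \<epsilon> / 2)) / exp (real n * (\<epsilon> / 2))"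
        unfolding exp_diff[symmetric] by (simp add: algebra_simps)
      also have "\<dots> \<le> exp (- real n * (?E + \<epsilon> / 2)) / 1024"
        using elim(1) by (intro divide_left_mono) auto
      also have "\<dots> \<le> 1 - avg_err_prob W R K P n"
        using avg_correct_ge_exp[OF W R K f _ elim(2)] \<epsilon> by (simp add: E)
      finally show ?case using elim(3) by simp
    qed
  qed
  \<comment> \<open>The infimum over codebooks is therefore a minimum of finitely many
    values.\<close>
  have fin: "finite (?S n)" and ne: "?S n \<noteq> {}" for n
    using codebooks_nonempty by (auto simp: setcompr_eq_image)
  have upper: "\<forall>\<^sub>F n in sequentially. Inf (?S n) \<le> ?E + \<epsilon>" if "0 < \<epsilon>" for \<epsilon>
    using avg[OF that]
  proof eventually_elim
    case (elim n)
    obtain C where C: "C \<in> codebooks (num_msgs R n) n" "1 - avg_err_prob W R K P n \<le> 1 - err_prob W R K n C"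
      by (rule exists_codebook[OF P])
    have "Inf (?S n) \<le> - (1 / real n) * ln (1 - err_prob W R K n C)"
      using C(1) by (intro cInf_lower bdd_below_finite fin) auto
    also have "\<dots> \<le> ?E + \<epsilon>" using elim C(2) by (intro neg_ln_le) auto
    finally show ?case .
  qed
  define k where "k = CARD('y) * CARD('x)"
  \<comment> \<open>The logarithm of the polynomial prefactor in \<open>correct_prob_le\<close>, per
    letter.\<close>
  define c where "c n = (k * ln (real n + 1) + ln (4 * (n * R + 3))) / n" for n :: nat
  have c: "c \<longlonglongrightarrow> 0" unfolding c_def using R by real_asymp
  have lower: "?E - c n \<le> Inf (?S n)" if n: "0 < n" for n
  proof (rule cInf_greatest[OF ne])
    fix v assume "v \<in> ?S n"
    then obtain C where v: "v = - (1 / real n) * ln (1 - err_prob W R K n C)" by auto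
    have a: "0 < real n * R + 3" using R by (simp add: add_nonneg_pos)
    have "ln (1 - err_prob W R K n C) \<le> ln (real ((n + 1) ^ k) * (4 * (n * R + 3)) * exp (- real n * ?E))"
      using correct_prob_le[OF W R K n, of C] correct_prob_pos[OF W R K, of n C] by (simp add: k_def)
    also have "\<dots> = k * ln (real n + 1) + ln (4 * (n * R + 3)) - n * ?E"
      using a by (simp add: ln_mult ln_realpow add.commute)
    finally have "ln (1 - err_prob W R K n C) \<le> n * (c n - ?E)"
      using n by (simp add: c_def right_diff_distrib)
    then show "?E - c n \<le> v" using n by (simp add: v field_simps)
  qed
  have "(\<lambda>n. Inf (?S n)) \<longlonglongrightarrow> ?E"
  proof (rule order_tendstoI)
    fix a assume "a < ?E"
    moreover have "(\<lambda>n. ?E - c n) \<longlonglongrightarrow> ?E - 0" by (intro tendsto_intros c)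
    ultimately have "\<forall>\<^sub>F n in sequentially. a < ?E - c n" using order_tendstoD(1) by fastforce
    then show "\<forall>\<^sub>F n in sequentially. a < Inf (?S n)"
      using eventually_gt_at_top[of 0] by eventually_elim (use lower less_le_trans in blast)
  next
    fix a assume "?E < a"
    then have "\<forall>\<^sub>F n in sequentially. Inf (?S n) \<le> ?E + (a - ?E) / 2" by (intro upper) simp
    then show "\<forall>\<^sub>F n in sequentially. Inf (?S n) < a"
    proof eventually_elim
      case (elim n)
      also have "?E + (a - ?E) / 2 < a" using \<open>?E < a\<close> by (simp add: field_simps)
      finally show ?case .
    qed
  qed
  \<comment> \<open>The same \<open>P\<close>, taken from the minimiser, works for every
    \<open>\<epsilon>\<close>, so the slack can be removed after taking the upper limit.\<close>
  moreover have "limsup (\<lambda>n. ereal (- (1 / real n) * ln (1 - avg_err_prob W R K P n))) \<le> ereal ?E"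
  proof (rule ereal_le_epsilon2)
    fix \<epsilon> :: real assume "0 < \<epsilon>"
    from avg[OF this]
    have "\<forall>\<^sub>F n in sequentially. ereal (- (1 / real n) * ln (1 - avg_err_prob W R K P n)) \<le> ereal (?E + \<epsilon>)"
      by eventually_elim (use neg_ln_le in auto)
    then show "limsup (\<lambda>n. ereal (- (1 / real n) * ln (1 - avg_err_prob W R K P n))) \<le> ereal ?E + ereal \<epsilon>"
      by (simp add: Limsup_bounded)
  qed
  ultimately show ?thesis using P by blast
qed

end
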